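(* Let $A,B$ be two nonempty open subsets of $\mathbb{R}^d$ and let $D_k$, $k\in K$, be the characteristic sets of $(A,B)$. Let $m\in L^\infty(\mathbb{R}^d)$ and let $T$ be the bounded linear operator on $L^2(\mathbb{R}^d)$ given by $(Tf)\hat{\,}=m\hat f$ for $f\in L^2(\mathbb{R}^d)$. Then $T$ satisfies the Bedrosian identity with respect to $(A,B)$ if and only if there exist constants $c_k\in\mathbb{C}$, $k\in K$, such that $$m=c_k\ \text{ almost everywhere on } D_k,\quad k\in K.$$ Here, if $D_k\cap D_{k'}$ is nonempty then $c_k=c_{k'}$.
   Context: Functions are complex-valued, and almost everywhere refers to Lebesgue measure on $\mathbb{R}^d$, denoted $|\cdot|$. The Fourier transform is $\hat f(\xi)=(2\pi)^{-d/2}\int_{\mathbb{R}^d}f(x)e^{-ix\cdot\xi}\,dx$ for $f\in L^1(\mathbb{R}^d)$, extended to $L^2(\mathbb{R}^d)$ in the usual way. Support: for a Lebesgue measurable function $\varphi$ on $\mathbb{R}^d$, $\operatorname{supp}\varphi$ is the set of all $x_0\in\mathbb{R}^d$ such that $|U\cap\{x:\varphi(x)\neq0\}|>0$ for every open neighborhood $U$ of $x_0$. Bedrosian identity: a bounded linear operator $T:L^2(\mathbb{R}^d)\to L^2(\mathbb{R}^d)$ satisfies the Bedrosian identity with respect to a pair $(A,B)$ of Lebesgue measurable sets $A,B\subseteq\mathbb{R}^d$ if $T(fg)=f\,(Tg)$ holds for all $f,g\in L^2(\mathbb{R}^d)\cap L^\infty(\mathbb{R}^d)$ with $\operatorname{supp}\hat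 f\subseteq A$ and $\operatorname{supp}\hat g\subseteq B$. Characteristic sets: for nonempty open $A,B\subseteq\mathbb{R}^d$, decompose $A$, $B$ and $A+B=\{a+b:a\in A,\ b\in B\}$ into their connected components, $A=\bigcup_{i\in I}A_i$, $B=\bigcup_{j\in J}B_j$, $A+B=\bigcup_{k\in K}C_k$. For each $k\in K$ put $J_k:=\{j\in J: A_i+B_j\subseteq C_k\text{ for some } i\in I\}$ and $D_k:=C_k\cup\bigcup_{j\in J_k}B_j$. The sets $D_k$, $k\in K$, are the characteristic sets of $(A,B)$. *)

theory Defs
  imports "HOL-Analysis.Analysis" "HOL-Library.Set_Algebras"
begin

text \<open>
  Elements of \<open>L\<^sup>2\<close> and \<open>L\<^sup>\<infinity>\<close> are represented by Lebesgue measurable functions; equality in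
  these spaces is equality almost everywhere.  The squared norm is extended-valued, so that it
  is meaningful without knowing beforehand that the function is square integrable.
\<close>

definition L2_norm_sq :: "(real ^ 'n \<Rightarrow> complex) \<Rightarrow> ennreal" where
  "L2_norm_sq f = (\<integral>\<^sup>+ x. ennreal ((norm (f x))\<^sup>2) \<partial>lebesgue)"

definition L2 :: "(real ^ 'n \<Rightarrow> complex) set" where
  "L2 = {f \<in> borel_measurable lebesgue. L2_norm_sq f < \<infinity>}"

definition L_infinity :: "(real ^ 'n \<Rightarrow> complex) set" where
  "L_infinity = {f \<in> borel_measurable lebesgue. \<exists>C::real. AE x in lebesgue. norm (f x) \<le> C}"

definition fourier_L1 :: "(real ^ 'n \<Rightarrow> complex) \<Rightarrow> real ^ 'n \<Rightarrow> complex" where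
  "fourier_L1 f \<xi> =
     complex_of_real ((2 * pi) powr (- real CARD('n) / 2)) *
     (\<integral>x. f x * exp (- (\<i> * complex_of_real (x \<bullet> \<xi>))) \<partial>lebesgue)"

text \<open>
  Extension to \<open>L\<^sup>2\<close> by continuity from the dense subspace \<open>L\<^sup>1 \<inter> L\<^sup>2\<close>.  By Plancherel's theorem
  the limit \<open>F\<close> exists for every \<open>f\<close> in \<open>L\<^sup>2\<close> and is unique up to equality almost everywhere;
  the choice operator below only picks a representative.
\<close>

definition has_fourier_L2 ::
    "(real ^ 'n \<Rightarrow> complex) \<Rightarrow> (real ^ 'n \<Rightarrow> complex) \<Rightarrow> bool" where
  "has_fourier_L2 f F \<longleftrightarrow> F \<in> L2 \<and>
     (\<exists>u :: nat \<Rightarrow> real ^ 'n \<Rightarrow> complex.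
        (\<forall>n. integrable lebesgue (u n) \<and> u n \<in> L2) \<and>
        (\<lambda>n. L2_norm_sq (\<lambda>x. u n x - f x)) \<longlonglongrightarrow> 0 \<and>
        (\<lambda>n. L2_norm_sq (\<lambda>\<xi>. fourier_L1 (u n) \<xi> - F \<xi>)) \<longlonglongrightarrow> 0)"

definition fourier_L2 :: "(real ^ 'n \<Rightarrow> complex) \<Rightarrow> real ^ 'n \<Rightarrow> complex" where
  "fourier_L2 f = (SOME F. has_fourier_L2 f F)"

definition ess_supp :: "(real ^ 'n \<Rightarrow> complex) \<Rightarrow> (real ^ 'n) set" where
  "ess_supp \<phi> =
     {x\<^sub>0. \<forall>U. open U \<and> x\<^sub>0 \<in> U \<longrightarrow> emeasure lebesgue (U \<inter> {x. \<phi> x \<noteq> 0}) > 0}"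

text \<open>
  The last conjunct is the boundedness \<open>\<parallel>T f\<parallel> \<le> K \<parallel>f\<parallel>\<close>, squared.  Together with linearity it makes
  \<open>T\<close> respect equality almost everywhere, so \<open>T\<close> acts on classes.
\<close>

definition L2_bounded_linear ::
    "((real ^ 'n \<Rightarrow> complex) \<Rightarrow> real ^ 'n \<Rightarrow> complex) \<Rightarrow> bool" where
  "L2_bounded_linear T \<longleftrightarrow>
     (\<forall>f\<in>L2. T f \<in> L2) \<and>
     (\<forall>f\<in>L2. \<forall>g\<in>L2. AE x in lebesgue. T (\<lambda>y. f y + g y) x = T f x + T g x) \<and>
     (\<forall>c. \<forall>f\<in>L2. AE x in lebesgue. T (\<lambda>y. c * f y) x = c * T f x) \<and>
     (\<exists>K::real. \<forall>f\<in>L2. L2_norm_sq (T f) \<le> ennreal (K\<^sup>2) * L2_norm_sq f)"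

definition bedrosian_identity ::
    "((real ^ 'n \<Rightarrow> complex) \<Rightarrow> real ^ 'n \<Rightarrow> complex) \<Rightarrow>
     (real ^ 'n) set \<Rightarrow> (real ^ 'n) set \<Rightarrow> bool" where
  "bedrosian_identity T A B \<longleftrightarrow>
     (\<forall>f \<in> L2 \<inter> L_infinity. \<forall>g \<in> L2 \<inter> L_infinity.
        ess_supp (fourier_L2 f) \<subseteq> A \<longrightarrow> ess_supp (fourier_L2 g) \<subseteq> B \<longrightarrow>
        (AE x in lebesgue. T (\<lambda>y. f y * g y) x = f x * T g x))"

text \<open>
  The characteristic sets are indexed by the connected components \<open>C\<close> of the Minkowski sum
  \<open>A + B\<close>.
\<close>

definition characteristic_set ::
    "(real ^ 'n) set \<Rightarrow> (real ^ 'n) set \<Rightarrow> (real ^ 'n) set \<Rightarrow> (real ^ 'n) set" where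
  "characteristic_set A B C =
     C \<union> \<Union> {B' \<in> components B. \<exists>A' \<in> components A. A' + B' \<subseteq> C}"

end

theory Submission
  imports Defs "HOL-Probability.Characteristic_Functions"
begin

text \<open>
  Write \<open>F\<close>, \<open>G\<close> for the Fourier transforms of \<open>f\<close>, \<open>g\<close>.  Parseval's identity gives the transform of
  the product \<open>f g\<close> as a multiple of
  the convolution of \<open>F\<close> and \<open>G\<close>, and hence \<open>T (f g) = f (T g)\<close> says that
  \<open>\<integral> F (\<xi> - \<eta>) G \<eta> (m \<xi> - m \<eta>) d\<eta> = 0\<close> for almost every \<open>\<xi>\<close>.  If \<open>F\<close> and \<open>G\<close> live on \<open>A\<close> and \<open>B\<close>, then
  the integrand is nonzero only if \<open>\<xi> - \<eta>\<close> and \<open>\<eta>\<close> lie in components of \<open>A\<close> and \<open>B\<close> whose sum is contained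
  in one component of \<open>A + B\<close>, so that \<open>\<xi>\<close> and \<open>\<eta>\<close> belong to a common characteristic set.
  Conversely, for \<open>a \<in> A\<close> and \<open>b \<in> B\<close> let \<open>F\<close> be the indicator of a ball around \<open>a\<close> and let \<open>G = h 1\<^sub>V\<close> with
  \<open>V\<close> a small ball around \<open>b\<close>.  Taking \<open>h = 1\<close> shows that \<open>m\<close> equals near \<open>a + b\<close> its average \<open>c\<close> over \<open>V\<close>,
  and then \<open>h = cnj (m - c)\<close> gives \<open>m = c\<close> on \<open>V\<close>.  Connectedness of the components of \<open>A + B\<close> finishes
  the proof.
\<close>

section \<open>Square integrable functions\<close>

text \<open>Plancherel's theorem is derived from the contraction inequality
  \<open>L2_norm_sq (fourier_L1 f) \<le> L2_norm_sq f\<close>. A transform is a priori only bounded,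
  so its squared modulus is first integrated against a Gaussian weight, which produces the inner
  product of \<open>f\<close> with a heat-kernel average of \<open>f\<close>. Given the contraction,
  the functions with equality are stable under sums and limits, so indicators of open sets suffice
  as a starting point. The functions \<open>f g\<close> and \<open>f (T g)\<close> are integrable as
  well as square integrable, so their transforms are convolution integrals meaningful at every
  frequency. In the converse direction \<open>F\<close> and \<open>G\<close> are prescribed while
  \<open>f\<close> and \<open>g\<close> must be bounded; this is why \<open>F\<close> and
  \<open>G\<close> are taken integrable and an inversion formula is required. The ball around
  \<open>a\<close> has twice the radius of \<open>V\<close>: its indicator is then 1 at every
  \<open>\<xi> - \<eta>\<close> that matters, and the convolution collapses to an integral over
  \<open>V\<close> that no longer involves \<open>\<xi>\<close>. On a component of \<open>B\<close>
  that belongs to a characteristic set, the constant is found by translating by a point of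
  \<open>A\<close> into the component of \<open>A + B\<close>.\<close>

lemma L2_iff:
  "f \<in> L2 \<longleftrightarrow> f \<in> borel_measurable lebesgue \<and> integrable lebesgue (\<lambda>x. (norm (f x))\<^sup>2)"
  unfolding L2_def L2_norm_sq_def by (auto simp: integrable_iff_bounded)

lemma L2_measurable [measurable_dest]: "f \<in> L2 \<Longrightarrow> f \<in> borel_measurable lebesgue"
  by (simp add: L2_iff)

lemma L2_norm_sq_eq_integral:
  "f \<in> L2 \<Longrightarrow> L2_norm_sq f = ennreal (\<integral>x. (norm (f x))\<^sup>2 \<partial>lebesgue)"
  unfolding L2_norm_sq_def by (rule nn_integral_eq_integral) (auto simp: L2_iff)

lemma L2_norm_sq_finite: "f \<in> L2 \<Longrightarrow> L2_norm_sq f < top"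
  by (simp add: L2_norm_sq_eq_integral)

lemma L2_I: "f \<in> borel_measurable lebesgue \<Longrightarrow> L2_norm_sq f < top \<Longrightarrow> f \<in> L2"
  by (simp add: L2_def)

lemma L2_norm_sq_cong_AE:
  "(AE x in lebesgue. norm (f x) = norm (g x)) \<Longrightarrow> L2_norm_sq f = L2_norm_sq g"
  unfolding L2_norm_sq_def by (rule nn_integral_cong_AE) auto

lemma L2_norm_sq_mono_AE:
  "(AE x in lebesgue. norm (f x) \<le> norm (g x)) \<Longrightarrow> L2_norm_sq f \<le> L2_norm_sq g"
  unfolding L2_norm_sq_def by (rule nn_integral_mono_AE) (auto intro!: ennreal_leI power_mono)

lemma L2_norm_sq_cmult: 
  assumes "f \<in> borel_measurable lebesgue"
  shows "L2_norm_sq (\<lambda>x. c * f x) = ennreal ((norm c)\<^sup>2) * L2_norm_sq f"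
  unfolding L2_norm_sq_def using assms
  by (subst nn_integral_cmult[symmetric]) (auto simp: norm_mult power_mult_distrib ennreal_mult)

text \<open>From \<open>2 |a| |b| \<le> t |a|^2 + |b|^2 / t\<close>. This replaces the triangle
  inequality without square roots of extended reals: a small \<open>t\<close> puts almost no loss on
  \<open>f\<close>, and \<open>t = 1\<close> gives the crude bound with factor 2.\<close>

lemma L2_norm_sq_weighted_triangle:
  assumes "f \<in> borel_measurable lebesgue" "g \<in> borel_measurable lebesgue" "0 < t"
  shows "L2_norm_sq (\<lambda>x. f x + g x) \<le>
    ennreal (1 + t) * L2_norm_sq f + ennreal (1 + 1 / t) * L2_norm_sq g"
proof -
  note [measurable] = assms(1,2)
  have *: "(norm (a + b))\<^sup>2 \<le> (1 + t) * (norm a)\<^sup>2 + (1 + 1 / t) * (norm b)\<^sup>2" for a b :: complex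
  proof -
    have "(norm (a + b))\<^sup>2 \<le> (norm a + norm b)\<^sup>2"
      by (intro power_mono norm_triangle_ineq) auto
    also have "\<dots> \<le> (1 + t) * (norm a)\<^sup>2 + (1 + 1 / t) * (norm b)\<^sup>2"
    proof -
      have "0 \<le> (t * norm a - norm b)\<^sup>2 / t" using assms(3) by simp
      also have "\<dots> = t * (norm a)\<^sup>2 - 2 * norm a * norm b + (norm b)\<^sup>2 / t"
        using assms(3) by (simp add: field_simps power2_eq_square)
      finally show ?thesis by (simp add: power2_sum algebra_simps)
    qed
    finally show ?thesis .
  qed
  have "L2_norm_sq (\<lambda>x. f x + g x) \<le>
      (\<integral>\<^sup>+x. ennreal (1 + t) * ennreal ((norm (f x))\<^sup>2) + ennreal (1 + 1 / t) * ennreal ((norm (g x))\<^sup>2) \<partial>lebesgue)"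
    unfolding L2_norm_sq_def
    using * assms(3) by (intro nn_integral_mono) (auto simp: ennreal_mult[symmetric] ennreal_plus[symmetric]
       simp del: ennreal_plus intro!: ennreal_leI)
  also have "\<dots> = ennreal (1 + t) * L2_norm_sq f + ennreal (1 + 1 / t) * L2_norm_sq g"
    unfolding L2_norm_sq_def by (simp add: nn_integral_add nn_integral_cmult)
  finally show ?thesis .
qed

lemma L2_norm_sq_add_le:
  assumes "f \<in> borel_measurable lebesgue" "g \<in> borel_measurable lebesgue"
  shows "L2_norm_sq (\<lambda>x. f x + g x) \<le> 2 * L2_norm_sq f + 2 * L2_norm_sq g"
  using L2_norm_sq_weighted_triangle[OF assms, of 1] by simp

lemma L2_add:
  assumes "f \<in> L2" "g \<in> L2" shows "(\<lambda>x. f x + g x) \<in> L2"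
proof (rule L2_I)
  show "(\<lambda>x. f x + g x) \<in> borel_measurable lebesgue" using assms by measurable
  have "L2_norm_sq (\<lambda>x. f x + g x) \<le> 2 * L2_norm_sq f + 2 * L2_norm_sq g"
    using assms by (intro L2_norm_sq_add_le L2_measurable)
  also have "\<dots> < top"
    using assms by (auto simp: ennreal_mult_less_top L2_norm_sq_finite)
  finally show "L2_norm_sq (\<lambda>x. f x + g x) < top" .
qed

lemma L2_bounded_mult:
  assumes "f \<in> L2" "h \<in> L_infinity" shows "(\<lambda>x. h x * f x) \<in> L2"
proof (rule L2_I)
  have [measurable]: "f \<in> borel_measurable lebesgue" "h \<in> borel_measurable lebesgue"
    using assms by (auto simp: L2_iff L_infinity_def)
  show "(\<lambda>x. h x * f x) \<in> borel_measurable lebesgue" by measurable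
  obtain C where C: "AE x in lebesgue. norm (h x) \<le> C"
    using assms by (auto simp: L_infinity_def)
  have "L2_norm_sq (\<lambda>x. h x * f x) \<le> L2_norm_sq (\<lambda>x. of_real \<bar>C\<bar> * f x)"
    using C by (intro L2_norm_sq_mono_AE) (auto simp: norm_mult intro!: mult_right_mono)
  also have "\<dots> < top"
    using assms by (auto simp: L2_norm_sq_cmult ennreal_mult_less_top L2_norm_sq_finite)
  finally show "L2_norm_sq (\<lambda>x. h x * f x) < top" .
qed

lemma const_L_infinity: "(\<lambda>x. c) \<in> L_infinity"
  by (auto simp: L_infinity_def)

lemma L2_cmult: "f \<in> L2 \<Longrightarrow> (\<lambda>x. c * f x) \<in> L2"
  using L2_bounded_mult[OF _ const_L_infinity] .

lemma L2_diff:
  assumes "f \<in> L2" "g \<in> L2" shows "(\<lambda>x. f x - g x) \<in> L2"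
  using L2_add[OF assms(1) L2_cmult[OF assms(2), of "-1"]] by simp

lemma L2_norm_sq_minus_commute: "L2_norm_sq (\<lambda>x. f x - g x) = L2_norm_sq (\<lambda>x. g x - f x)"
  by (intro L2_norm_sq_cong_AE) (auto simp: norm_minus_commute)

lemma borel_measurable_cnj [measurable]: "cnj \<in> borel_measurable borel"
  by (intro borel_measurable_continuous_onI continuous_on_cnj continuous_on_id)

lemma L2_cnj: "f \<in> L2 \<Longrightarrow> (\<lambda>x. cnj (f x)) \<in> L2"
  by (auto simp: L2_iff intro: measurable_compose[OF _ borel_measurable_cnj])

lemma L2_mult_integrable:
  assumes "f \<in> L2" "g \<in> L2" shows "integrable lebesgue (\<lambda>x. f x * g x)"
proof (rule Bochner_Integration.integrable_bound)
  have [measurable]: "f \<in> borel_measurable lebesgue" "g \<in> borel_measurable lebesgue"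
    using assms by (auto simp: L2_iff)
  show "integrable lebesgue (\<lambda>x. (norm (f x))\<^sup>2 + (norm (g x))\<^sup>2)"
    using assms by (auto simp: L2_iff)
  show "(\<lambda>x. f x * g x) \<in> borel_measurable lebesgue" by measurable
  have "norm (a * b) \<le> (norm a)\<^sup>2 + (norm b)\<^sup>2" for a b :: complex
    using sum_squares_bound[of "norm a" "norm b"] mult_nonneg_nonneg[of "norm a" "norm b", OF norm_ge_zero norm_ge_zero]
    unfolding norm_mult by linarith
  then show "AE x in lebesgue. norm (f x * g x) \<le> norm ((norm (f x))\<^sup>2 + (norm (g x))\<^sup>2)"
    by (intro AE_I2) auto
qed

lemma L2_norm_sq_eq_0_iff:
  assumes "f \<in> borel_measurable lebesgue"
  shows "L2_norm_sq f = 0 \<longleftrightarrow> (AE x in lebesgue. f x = 0)"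
  using assms unfolding L2_norm_sq_def by (subst nn_integral_0_iff_AE) (auto intro!: AE_cong)

lemma L2_norm_sq_parallelogram:
  assumes "f \<in> borel_measurable lebesgue" "g \<in> borel_measurable lebesgue"
  shows "L2_norm_sq (\<lambda>x. f x + g x) + L2_norm_sq (\<lambda>x. f x - g x) = 2 * L2_norm_sq f + 2 * L2_norm_sq g"
proof -
  note [measurable] = assms
  have *: "(norm (a + b))\<^sup>2 + (norm (a - b))\<^sup>2 = 2 * (norm a)\<^sup>2 + 2 * (norm b)\<^sup>2" for a b :: complex
    by (simp add: cmod_power2 power2_sum power2_diff)
  have "L2_norm_sq (\<lambda>x. f x + g x) + L2_norm_sq (\<lambda>x. f x - g x) =
      (\<integral>\<^sup>+x. 2 * ennreal ((norm (f x))\<^sup>2) + 2 * ennreal ((norm (g x))\<^sup>2) \<partial>lebesgue)"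
    unfolding L2_norm_sq_def
    by (subst nn_integral_add[symmetric], measurable)
       (intro nn_integral_cong, simp add: ennreal_plus[symmetric] * ennreal_mult[symmetric] ennreal_numeral[symmetric]
          del: ennreal_plus ennreal_numeral)
  also have "\<dots> = 2 * L2_norm_sq f + 2 * L2_norm_sq g"
    unfolding L2_norm_sq_def by (simp add: nn_integral_add nn_integral_cmult)
  finally show ?thesis .
qed

text \<open>The weighted triangle inequality is applied to \<open>u n = f + (u n - f)\<close> and to
  \<open>f = u n + (f - u n)\<close>. The error carries the large factor \<open>1 + 1 / t\<close>,
  but for fixed \<open>t\<close> it tends to 0, and the remaining factor \<open>1 + t\<close> is as
  close to 1 as desired.\<close>

lemma L2_norm_sq_tendsto:
  assumes u: "\<And>n. u n \<in> L2" and f: "f \<in> L2"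
    and lim: "(\<lambda>n. L2_norm_sq (\<lambda>x. u n x - f x)) \<longlonglongrightarrow> 0"
  shows "(\<lambda>n. L2_norm_sq (u n)) \<longlonglongrightarrow> L2_norm_sq f"
proof -
  define N where "N h = (\<integral>x. (norm (h x))\<^sup>2 \<partial>lebesgue)" for h :: "real ^ 'a \<Rightarrow> complex"
  have N0: "0 \<le> N h" for h unfolding N_def by simp
  have N: "L2_norm_sq h = ennreal (N h)" if "h \<in> L2" for h
    using that by (simp add: N_def L2_norm_sq_eq_integral)
  define d where "d n = N (\<lambda>x. u n x - f x)" for n
  have d: "d \<longlonglongrightarrow> 0"
  proof -
    have "L2_norm_sq (\<lambda>x. u n x - f x) = ennreal (d n)" for n
      unfolding d_def by (intro N L2_diff u f)
    with lim show ?thesis by (simp add: tendsto_ennreal_iff[of d sequentially 0, unfolded ennreal_0, symmetric] always_eventually d_def N0 del: ennreal_eq_0_iff)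
  qed
  have tri: "N (\<lambda>x. g x + h x) \<le> (1 + t) * N g + (1 + 1 / t) * N h"
    if "g \<in> L2" "h \<in> L2" "0 < t" for g h t
    using L2_norm_sq_weighted_triangle[of g h t] that
    by (auto simp: N L2_add L2_measurable ennreal_mult[symmetric] ennreal_plus[symmetric] N0 
        simp del: ennreal_plus intro!: add_nonneg_nonneg mult_nonneg_nonneg)
  have up: "N (u n) \<le> (1 + t) * N f + (1 + 1 / t) * d n" if "0 < t" for t n
    using tri[OF f L2_diff[OF u f] that, of n] by (simp add: d_def)
  have dn: "N f \<le> (1 + t) * N (u n) + (1 + 1 / t) * d n" if "0 < t" for t n
    using tri[OF u L2_diff[OF f u] that, of n n] L2_norm_sq_minus_commute[of f "u n"]
    by (simp add: d_def N L2_diff u f N0)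
  have "(\<lambda>n. N (u n)) \<longlonglongrightarrow> N f"
  proof (rule order_tendstoI)
    fix a assume a: "a < N f"
    \<comment> \<open>For \<open>a > 0\<close> the witness is half of the critical value
      \<open>N f / a - 1\<close>; for \<open>a \<le> 0\<close> every positive \<open>t\<close>
      works.\<close>
    obtain t where t: "0 < t" "a * (1 + t) < N f"
    proof (cases "a > 0")
      case True
      show ?thesis 
        by (rule that[of "(N f - a) / (2 * a)"]) (use a True in \<open>auto simp: field_simps\<close>)
    next
      case False
      show ?thesis by (rule that[of 1]) (use a False in auto)
    qed
    have "((\<lambda>n. (N f - (1 + 1 / t) * d n) / (1 + t)) \<longlongrightarrow> (N f - (1 + 1 / t) * 0) / (1 + t)) sequentially"
      by (intro tendsto_intros d) (use t in auto)
    moreover have "a < (N f - (1 + 1 / t) * 0) / (1 + t)" using t by (simp add: field_simps)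
    ultimately have "\<forall>\<^sub>F n in sequentially. a < (N f - (1 + 1 / t) * d n) / (1 + t)"
      by (rule order_tendstoD(1))
    then show "\<forall>\<^sub>F n in sequentially. a < N (u n)"
    proof eventually_elim
      case (elim n)
      have "(N f - (1 + 1 / t) * d n) / (1 + t) \<le> N (u n)"
        using dn[OF t(1), of n] t(1) by (simp add: pos_divide_le_eq mult.commute)
      with elim show ?case by simp
    qed
  next
    fix a assume a: "N f < a"
    obtain t where t: "0 < t" "(1 + t) * N f < a"
    proof (cases "N f > 0")
      case True
      show ?thesis 
        by (rule that[of "(a - N f) / (2 * N f)"]) (use a True in \<open>auto simp: field_simps\<close>)
    next
      case False
      show ?thesis by (rule that[of 1]) (use a False N0[of f] in auto)
    qed
    have "((\<lambda>n. (1 + t) * N f + (1 + 1 / t) * d n) \<longlongrightarrow> (1 + t) * N f + (1 + 1 / t) * 0) sequentially"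
      by (intro tendsto_intros d)
    moreover have "(1 + t) * N f + (1 + 1 / t) * 0 < a" using t by simp
    ultimately have "\<forall>\<^sub>F n in sequentially. (1 + t) * N f + (1 + 1 / t) * d n < a"
      by (rule order_tendstoD(2))
    then show "\<forall>\<^sub>F n in sequentially. N (u n) < a"
      using up[OF t(1)] by (auto elim!: eventually_mono intro: le_less_trans)
  qed
  then show ?thesis using u f by (simp add: N N0 tendsto_ennrealI)
qed

text \<open>The weights \<open>2\<^sup>n\<close> make \<open>\<Sum>n. 2\<^sup>n |u (n + 1) - u n|\<^sup>2\<close> integrable and at the same time force
  the increments to be dominated, almost everywhere, by a geometric sequence.\<close>

lemma L2_complete_fast:
  fixes u :: "nat \<Rightarrow> real ^ 'n \<Rightarrow> complex"
  assumes u: "\<And>n. u n \<in> L2"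
    and fast: "\<And>n k. n \<le> k \<Longrightarrow> L2_norm_sq (\<lambda>x. u k x - u n x) \<le> ennreal ((1/4) ^ n)"
  shows "\<exists>F\<in>L2. (\<lambda>n. L2_norm_sq (\<lambda>x. u n x - F x)) \<longlonglongrightarrow> 0"
proof -
  have [measurable]: "u n \<in> borel_measurable lebesgue" for n using u[of n] by (simp add: L2_iff)
  \<comment> \<open>Where the sequence diverges, \<open>F\<close> has an arbitrary value; those
    points turn out to form a null set, and \<open>lim\<close> keeps \<open>F\<close>
    measurable.\<close>
  define F where "F x = lim (\<lambda>n. u n x)" for x
  have F_meas [measurable]: "F \<in> borel_measurable lebesgue" unfolding F_def by measurable
  let ?s = "\<lambda>n x. ennreal (2 ^ n * (norm (u (Suc n) x - u n x))\<^sup>2)"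
  have "(\<integral>\<^sup>+x. (\<Sum>n. ?s n x) \<partial>lebesgue) = (\<Sum>n. \<integral>\<^sup>+x. ?s n x \<partial>lebesgue)"
    by (rule nn_integral_suminf) measurable
  also have "\<dots> \<le> (\<Sum>n. ennreal ((1/2) ^ n))"
  proof (intro suminf_le allI)
    fix n
    have "(\<integral>\<^sup>+x. ?s n x \<partial>lebesgue) = ennreal (2 ^ n) * L2_norm_sq (\<lambda>x. u (Suc n) x - u n x)"
      unfolding L2_norm_sq_def by (subst nn_integral_cmult[symmetric]) (auto simp: ennreal_mult)
    also have "\<dots> \<le> ennreal (2 ^ n) * ennreal ((1/4) ^ n)"
      by (intro mult_left_mono fast) auto
    also have "\<dots> = ennreal ((1/2) ^ n)"
      by (simp add: ennreal_mult[symmetric] power_mult_distrib[symmetric])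
    finally show "(\<integral>\<^sup>+x. ?s n x \<partial>lebesgue) \<le> ennreal ((1/2) ^ n)" .
  qed auto
  also have "\<dots> < top"
    by (subst suminf_ennreal_eq[OF _ geometric_sums]) auto
  finally have "(\<integral>\<^sup>+x. (\<Sum>n. ?s n x) \<partial>lebesgue) \<noteq> \<infinity>" by simp
  then have "AE x in lebesgue. (\<Sum>n. ?s n x) \<noteq> \<infinity>"
    by (intro nn_integral_noteq_infinite) measurable
  then have conv: "AE x in lebesgue. (\<lambda>n. u n x) \<longlonglongrightarrow> F x"
  proof eventually_elim
    case (elim x)
    then have "summable (\<lambda>n. 2 ^ n * (norm (u (Suc n) x - u n x))\<^sup>2)"
      by (intro summable_suminf_not_top) auto
    then have "Bseq (\<lambda>n. 2 ^ n * (norm (u (Suc n) x - u n x))\<^sup>2)"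
      by (auto intro: convergent_imp_Bseq convergentI dest: summable_LIMSEQ_zero)
    then obtain C where C: "C > 0" "\<And>n. 2 ^ n * (norm (u (Suc n) x - u n x))\<^sup>2 \<le> C"
      by (auto simp: Bseq_def)
    define q :: real where "q = sqrt (1/2)"
    have q: "0 < q" "q < 1" "q\<^sup>2 = 1/2" unfolding q_def by auto
    have le: "norm (u (Suc n) x - u n x) \<le> sqrt C * q ^ n" for n
    proof (rule power2_le_imp_le)
      have "(q ^ n)\<^sup>2 = (1/2) ^ n" using q by (metis power_commutes power_mult mult.commute)
      then show "(norm (u (Suc n) x - u n x))\<^sup>2 \<le> (sqrt C * q ^ n)\<^sup>2"
        using C(1) C(2)[of n] unfolding power_mult_distrib \<open>(q ^ n)\<^sup>2 = (1/2) ^ n\<close>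
        by (simp add: power_one_over divide_simps mult.commute)
    qed (use q(1) C(1) in auto)
    have "summable (\<lambda>n. u (Suc n) x - u n x)"
      by (rule summable_comparison_test'[where g = "\<lambda>n. sqrt C * q ^ n" and N = 0])
         (use le q(1,2) in \<open>simp_all add: summable_mult summable_geometric\<close>)
    then have "convergent (\<lambda>n. \<Sum>i<n. u (Suc i) x - u i x)"
      by (simp add: summable_iff_convergent)
    then have "convergent (\<lambda>n. (\<Sum>i<n. u (Suc i) x - u i x) + u 0 x)"
      by (intro convergent_add convergent_const)
    moreover have "(\<Sum>i<n. u (Suc i) x - u i x) = u n x - u 0 x" for n
      by (induction n) auto
    ultimately have "convergent (\<lambda>n. u n x)" by simp
    then show ?case by (simp add: F_def convergent_LIMSEQ_iff)
  qed
  \<comment> \<open>Fatou's lemma in \<open>k\<close> turns the Cauchy bound between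
    \<open>u k\<close> and \<open>u n\<close> into a bound on the distance from \<open>u n\<close>
    to the limit.\<close>
  have bd: "L2_norm_sq (\<lambda>x. u n x - F x) \<le> ennreal ((1/4) ^ n)" for n
  proof -
    have "L2_norm_sq (\<lambda>x. u n x - F x) = (\<integral>\<^sup>+x. liminf (\<lambda>k. ennreal ((norm (u k x - u n x))\<^sup>2)) \<partial>lebesgue)"
      unfolding L2_norm_sq_def
    proof (rule nn_integral_cong_AE)
      show "AE x in lebesgue. ennreal ((norm (u n x - F x))\<^sup>2) = liminf (\<lambda>k. ennreal ((norm (u k x - u n x))\<^sup>2))"
        using conv
      proof eventually_elim
        case (elim x)
        have "(\<lambda>k. ennreal ((norm (u k x - u n x))\<^sup>2)) \<longlonglongrightarrow> ennreal ((norm (F x - u n x))\<^sup>2)"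
          by (intro tendsto_intros elim)
        from lim_imp_Liminf[OF _ this] show ?case by (simp add: norm_minus_commute)
      qed
    qed
    also have "\<dots> \<le> liminf (\<lambda>k. \<integral>\<^sup>+x. ennreal ((norm (u k x - u n x))\<^sup>2) \<partial>lebesgue)"
      by (rule nn_integral_liminf) measurable
    also have "\<dots> \<le> ennreal ((1/4) ^ n)"
    proof (rule Liminf_le)
      show "\<forall>\<^sub>F k in sequentially. (\<integral>\<^sup>+x. ennreal ((norm (u k x - u n x))\<^sup>2) \<partial>lebesgue) \<le> ennreal ((1/4) ^ n)"
        using fast[of n] unfolding L2_norm_sq_def by (auto simp: eventually_sequentially)
    qed auto
    finally show ?thesis .
  qed
  have "(\<lambda>x. u 0 x - F x) \<in> L2"
    using bd[of 0] by (intro L2_I) (auto intro: le_less_trans)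
  from L2_diff[OF u[of 0] this] have "F \<in> L2" by simp
  moreover have "(\<lambda>n. L2_norm_sq (\<lambda>x. u n x - F x)) \<longlonglongrightarrow> 0"
  proof (rule tendsto_sandwich[OF _ _ tendsto_const])
    have "(\<lambda>n. ennreal ((1/4) ^ n)) \<longlonglongrightarrow> ennreal 0"
      by (intro tendsto_ennrealI LIMSEQ_realpow_zero) auto
    then show "(\<lambda>n. ennreal ((1/4) ^ n)) \<longlonglongrightarrow> 0" by simp
  qed (use bd in auto)
  ultimately show ?thesis by blast
qed

section \<open>The Fourier transform of integrable functions\<close>

lemma sigma_finite_lebesgue: "sigma_finite_measure (lebesgue :: 'a::euclidean_space measure)"
proof
  have "(\<Union>n. cball (0::'a) (real n)) = UNIV"
    by (auto simp: real_arch_simple)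
  moreover have "emeasure lebesgue (cball (0::'a) r) \<noteq> \<infinity>" for r
    using fmeasurableD2[OF lmeasurable_cball[of "0::'a" r]] by simp
  ultimately show "\<exists>A. countable A \<and> A \<subseteq> sets lebesgue \<and> \<Union>A = space (lebesgue :: 'a measure) \<and>
      (\<forall>a\<in>A. emeasure lebesgue a \<noteq> \<infinity>)"
    by (intro exI[of _ "range (\<lambda>n::nat. cball 0 (real n))"])
       (auto simp del: emeasure_completion)
qed

interpretation lebesgue: sigma_finite_measure "lebesgue :: 'a::euclidean_space measure"
  by (rule sigma_finite_lebesgue)

interpretation lebesgue_pair: pair_sigma_finite
  "lebesgue :: 'a::euclidean_space measure" "lebesgue :: 'b::euclidean_space measure" ..

lemma ident_borel_measurable_lebesgue: "(\<lambda>x::'a::euclidean_space. x) \<in> borel_measurable lebesgue"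
  by (intro measurable_completion) simp

text \<open>An affine change of variables with factor -1 in each coordinate, whose determinant has
  absolute value 1. It makes \<open>F (\<xi> - \<eta>)\<close>, as a function of
  \<open>\<eta>\<close>, as good as \<open>F\<close> itself.\<close>

lemma lebesgue_reflect:
  fixes t :: "'a::euclidean_space"
  shows measurable_lebesgue_reflect: "(\<lambda>x. t - x) \<in> lebesgue \<rightarrow>\<^sub>M lebesgue"
    and distr_lebesgue_reflect: "distr lebesgue lebesgue (\<lambda>x. t - x) = lebesgue"
proof -
  have eq: "(\<lambda>x. t + (\<Sum>j\<in>Basis. (- 1 * (x \<bullet> j)) *\<^sub>R j)) = (\<lambda>x. t - x)"
    by (simp add: sum_negf euclidean_representation)
  show "(\<lambda>x. t - x) \<in> lebesgue \<rightarrow>\<^sub>M lebesgue"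
    using lebesgue_affine_measurable[of "\<lambda>_. -1" t] unfolding eq by simp
  have "lebesgue = density (distr lebesgue lebesgue (\<lambda>x. t - x)) (\<lambda>_. 1)"
    using lebesgue_affine_euclidean[of "\<lambda>_. -1" t] unfolding eq by simp
  then show "distr lebesgue lebesgue (\<lambda>x. t - x) = lebesgue"
    by (simp add: density_1)
qed

lemma nn_integral_lebesgue_reflect:
  fixes t :: "'a::euclidean_space"
  assumes "f \<in> borel_measurable lebesgue"
  shows "(\<integral>\<^sup>+x. f (t - x) \<partial>lebesgue) = (\<integral>\<^sup>+x. f x \<partial>lebesgue)"
  using nn_integral_distr[OF measurable_lebesgue_reflect[of t], of f] assms
  by (simp add: distr_lebesgue_reflect)

lemma AE_lebesgue_reflect:
  fixes t :: "'a::euclidean_space"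
  assumes "AE x in lebesgue. P x"
  shows "AE x in lebesgue. P (t - x)"
proof -
  obtain N where N: "N \<in> null_sets lebesgue" "{x. \<not> P x} \<subseteq> N"
    using assms unfolding eventually_ae_filter by auto
  have "AE x in distr lebesgue lebesgue (\<lambda>x. t - x). x \<notin> N"
    unfolding distr_lebesgue_reflect using N(1) by (rule AE_not_in)
  then have "AE x in lebesgue. t - x \<notin> N"
    by (rule AE_distrD[OF measurable_lebesgue_reflect])
  then show ?thesis by eventually_elim (use N(2) in blast)
qed

section \<open>Phases and elementary properties of the Fourier integral\<close>

abbreviation phase :: "real ^ 'n \<Rightarrow> real ^ 'n \<Rightarrow> complex" where
  "phase x \<xi> \<equiv> exp (- (\<i> * complex_of_real (x \<bullet> \<xi>)))"

abbreviation fourier_const :: "'n itself \<Rightarrow> real" where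
  "fourier_const _ \<equiv> (2 * pi) powr (- real CARD('n) / 2)"

lemma norm_phase: "norm (phase x \<xi>) = 1"
  by simp

lemma phase_add: "phase x (\<xi> + \<eta>) = phase x \<xi> * phase x \<eta>"
  by (simp add: inner_add_right exp_add[symmetric] algebra_simps)

lemma cnj_phase: "cnj (phase x \<xi>) = phase x (- \<xi>)"
  by (simp add: exp_cnj)

lemma phase_commute: "phase x \<xi> = phase \<xi> x"
  by (simp add: inner_commute)

lemma phase_measurable [measurable]: "(\<lambda>x. phase x \<xi>) \<in> borel_measurable lebesgue"
  by (intro measurable_completion) measurable

lemma phase_pair_measurable [measurable]:
  "(\<lambda>p. phase (fst p) (snd p)) \<in> borel_measurable (lebesgue \<Otimes>\<^sub>M lebesgue)"
proof -
  have [measurable]: "fst \<in> borel_measurable (lebesgue \<Otimes>\<^sub>M lebesgue)"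
    "snd \<in> borel_measurable (lebesgue \<Otimes>\<^sub>M lebesgue)"
    using measurable_compose[OF measurable_fst ident_borel_measurable_lebesgue]
      measurable_compose[OF measurable_snd ident_borel_measurable_lebesgue] by auto
  show ?thesis by measurable
qed

lemma integrable_mult_phase:
  "integrable lebesgue f \<Longrightarrow> integrable lebesgue (\<lambda>x. f x * phase x \<xi>)"
  by (rule Bochner_Integration.integrable_bound[of _ f]) (auto simp: norm_mult)

lemma norm_fourier_L1_le:
  fixes f :: "real ^ 'n \<Rightarrow> complex"
  shows "norm (fourier_L1 f \<xi>) \<le> fourier_const TYPE('n) * (\<integral>x. norm (f x) \<partial>lebesgue)"
proof -
  have "norm (\<integral>x. f x * phase x \<xi> \<partial>lebesgue) \<le> (\<integral>x. norm (f x * phase x \<xi>) \<partial>lebesgue)"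
    by (rule integral_norm_bound)
  then show ?thesis
    by (auto simp: fourier_L1_def norm_mult intro!: mult_left_mono)
qed

lemma fourier_L1_add:
  "integrable lebesgue f \<Longrightarrow> integrable lebesgue g \<Longrightarrow>
    fourier_L1 (\<lambda>x. f x + g x) \<xi> = fourier_L1 f \<xi> + fourier_L1 g \<xi>"
  by (simp add: fourier_L1_def distrib_right distrib_left integrable_mult_phase)

lemma fourier_L1_cmult: "fourier_L1 (\<lambda>x. a * f x) \<xi> = a * fourier_L1 f \<xi>"
  by (simp add: fourier_L1_def mult.assoc mult.left_commute)

lemma fourier_L1_diff:
  "integrable lebesgue f \<Longrightarrow> integrable lebesgue g \<Longrightarrow>
    fourier_L1 (\<lambda>x. f x - g x) \<xi> = fourier_L1 f \<xi> - fourier_L1 g \<xi>"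
  by (simp add: fourier_L1_def left_diff_distrib right_diff_distrib integrable_mult_phase)

text \<open>Modulation translates the transform and conjugation reflects it. Together they create
  the argument \<open>\<xi> - \<eta>\<close> of a convolution, so that Parseval's identity can later
  compute the transform of a product.\<close>

lemma fourier_L1_cnj_modulated:
  "fourier_L1 (\<lambda>x. cnj (f x * phase x \<xi>)) \<eta> = cnj (fourier_L1 f (\<xi> - \<eta>))"
proof -
  have "cnj (f x * phase x \<xi>) * phase x \<eta> = cnj (f x * phase x (\<xi> - \<eta>))" for x
    using phase_add[of x "-\<xi>" "\<eta>"] by (simp add: cnj_phase del: exp_minus)
  then show ?thesis
    unfolding fourier_L1_def by (simp del: complex_cnj_mult add: complex_cnj_mult[of "complex_of_real _"])
qed

lemma continuous_fourier_L1:
  assumes "integrable lebesgue f"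
  shows "continuous_on UNIV (fourier_L1 f)"
proof -
  have [measurable]: "f \<in> borel_measurable lebesgue" using assms by auto
  have "isCont (\<lambda>\<xi>. \<integral>x. f x * phase x \<xi> \<partial>lebesgue) \<xi>" for \<xi>
    unfolding continuous_at_sequentially
  proof safe
    fix s assume s: "s \<longlonglongrightarrow> \<xi>"
    show "((\<lambda>\<xi>. \<integral>x. f x * phase x \<xi> \<partial>lebesgue) \<circ> s) \<longlonglongrightarrow> (\<integral>x. f x * phase x \<xi> \<partial>lebesgue)"
      unfolding comp_def
    proof (rule integral_dominated_convergence[where w = "\<lambda>x. norm (f x)"])
      show "AE x in lebesgue. (\<lambda>i. f x * phase x (s i)) \<longlonglongrightarrow> f x * phase x \<xi>"
        by (intro AE_I2 tendsto_intros s)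
    qed (use assms in \<open>auto simp: norm_mult\<close>)
  qed
  then show ?thesis
    unfolding fourier_L1_def[abs_def] by (intro continuous_at_imp_continuous_on ballI continuous_intros) auto
qed

lemma fourier_L1_measurable:
  "integrable lebesgue f \<Longrightarrow> fourier_L1 f \<in> borel_measurable lebesgue"
  by (intro measurable_completion) (simp add: borel_measurable_continuous_onI continuous_fourier_L1)

lemma fourier_L1_L_infinity: "integrable lebesgue f \<Longrightarrow> fourier_L1 f \<in> L_infinity"
  unfolding L_infinity_def using fourier_L1_measurable norm_fourier_L1_le by blast

lemma integrable_mult_L_infinity:
  assumes "integrable lebesgue f" "h \<in> L_infinity"
  shows "integrable lebesgue (\<lambda>x. h x * f x)"
proof -
  have [measurable]: "f \<in> borel_measurable lebesgue" "h \<in> borel_measurable lebesgue"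
    using assms by (auto simp: L_infinity_def)
  obtain C where C: "AE x in lebesgue. norm (h x) \<le> C"
    using assms by (auto simp: L_infinity_def)
  show ?thesis
    by (rule Bochner_Integration.integrable_bound[of _ "\<lambda>x. of_real C * f x"])
       (use assms C in \<open>auto simp: norm_mult intro!: mult_right_mono\<close>)
qed

text \<open>Fubini for the kernel \<open>phase x y\<close>, which is symmetric and of modulus 1.
  Both the Gaussian regularization and the inversion formula rest on moving the transform from one
  factor to the other.\<close>

lemma fourier_L1_mult_formula:
  assumes f: "integrable lebesgue f" and g: "integrable lebesgue g"
  shows "(\<integral>\<xi>. fourier_L1 f \<xi> * g \<xi> \<partial>lebesgue) = (\<integral>x. f x * fourier_L1 g x \<partial>lebesgue)"
proof -
  have [measurable]: "f \<in> borel_measurable lebesgue" "g \<in> borel_measurable lebesgue"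
    using assms by auto
  have eq: "(\<lambda>(x, y). f x * g y * phase x y) = (\<lambda>p. f (fst p) * g (snd p) * phase (fst p) (snd p))"
    by auto
  have int: "integrable (lebesgue \<Otimes>\<^sub>M lebesgue) (\<lambda>(x, y). f x * g y * phase x y)"
  proof (rule lebesgue_pair.Fubini_integrable)
    show "(\<lambda>(x, y). f x * g y * phase x y) \<in> borel_measurable (lebesgue \<Otimes>\<^sub>M lebesgue)"
      unfolding eq by measurable
    show "integrable lebesgue (\<lambda>x. \<integral>y. norm (case (x, y) of (x, y) \<Rightarrow> f x * g y * phase x y) \<partial>lebesgue)"
      using assms by (simp add: norm_mult)
    show "AE x in lebesgue. integrable lebesgue (\<lambda>y. case (x, y) of (x, y) \<Rightarrow> f x * g y * phase x y)"
      using integrable_mult_phase[OF g]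
      by (intro AE_I2) (simp add: mult.assoc phase_commute)
  qed
  define k where "k = complex_of_real (fourier_const TYPE('a))"
  have 1: "fourier_L1 f \<xi> * g \<xi> = k * (\<integral>x. f x * g \<xi> * phase x \<xi> \<partial>lebesgue)" for \<xi>
  proof -
    have "(\<integral>x. f x * g \<xi> * phase x \<xi> \<partial>lebesgue) = (\<integral>x. g \<xi> * (f x * phase x \<xi>) \<partial>lebesgue)"
      by (simp only: mult_ac)
    also have "\<dots> = g \<xi> * (\<integral>x. f x * phase x \<xi> \<partial>lebesgue)"
      by (rule integral_mult_right_zero)
    finally show ?thesis by (simp only: fourier_L1_def k_def mult_ac)
  qed
  have 2: "f x * fourier_L1 g x = k * (\<integral>\<xi>. f x * g \<xi> * phase x \<xi> \<partial>lebesgue)" for x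
  proof -
    have "(\<integral>\<xi>. f x * g \<xi> * phase x \<xi> \<partial>lebesgue) = (\<integral>\<xi>. f x * (g \<xi> * phase \<xi> x) \<partial>lebesgue)"
      by (simp only: mult_ac inner_commute)
    also have "\<dots> = f x * (\<integral>\<xi>. g \<xi> * phase \<xi> x \<partial>lebesgue)"
      by (rule integral_mult_right_zero)
    finally show ?thesis by (simp only: fourier_L1_def k_def mult_ac)
  qed
  show ?thesis
    unfolding 1 2 integral_mult_right_zero
    using lebesgue_pair.Fubini_integral[OF int] by simp
qed

section \<open>Gaussian regularization\<close>

text \<open>For \<open>a = 1\<close> this is the characteristic function of the standard normal
  distribution, freed from the normalization of its density. Replacing \<open>t\<close> by
  \<open>a * t\<close> and \<open>s\<close> by \<open>s / a\<close> gives the general case.\<close>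

lemma gaussian_fourier_real:
  fixes s a :: real
  assumes "0 < a"
  shows "integrable lborel (\<lambda>t. complex_of_real (exp (- (a * t)\<^sup>2 / 2)) * exp (- (\<i> * complex_of_real (t * s))))" (is ?I)
    and "(\<integral>t. complex_of_real (exp (- (a * t)\<^sup>2 / 2)) * exp (- (\<i> * complex_of_real (t * s))) \<partial>lborel) =
      complex_of_real (sqrt (2 * pi) / a * exp (- (s / a)\<^sup>2 / 2))" (is ?V)
proof -
  have int1: "integrable lborel (\<lambda>t::real. exp (- t\<^sup>2 / 2))"
  proof -
    have "(\<lambda>t::real. exp (- t\<^sup>2 / 2)) = (\<lambda>t. sqrt (2 * pi) * std_normal_density t)"
      by (simp add: std_normal_density_def fun_eq_iff)
    then show ?thesis by (simp only: integrable_mult_right integrable_normal_density)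
  qed
  have int0: "integrable lborel (\<lambda>t. complex_of_real (exp (- t\<^sup>2 / 2)) * exp (- (\<i> * complex_of_real (t * r))))" for r
    by (rule Bochner_Integration.integrable_bound[OF int1]) (auto simp: norm_mult)
  have val0: "(\<integral>t. complex_of_real (exp (- t\<^sup>2 / 2)) * exp (- (\<i> * complex_of_real (t * r))) \<partial>lborel) =
      complex_of_real (sqrt (2 * pi) * exp (- r\<^sup>2 / 2))" for r
  proof -
    have "complex_of_real (exp (- r\<^sup>2 / 2)) = char std_normal_distribution (- r)"
      by (simp add: char_std_normal_distribution)
    also have "\<dots> = (\<integral>t. std_normal_density t *\<^sub>R exp (\<i> * complex_of_real (- r * t)) \<partial>lborel)"
      unfolding char_def by (subst integral_density) (auto simp: mult_ac)
    also have "\<dots> = (\<integral>t. complex_of_real (1 / sqrt (2 * pi)) * (complex_of_real (exp (- t\<^sup>2 / 2)) *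
        exp (- (\<i> * complex_of_real (t * r)))) \<partial>lborel)"
      by (intro Bochner_Integration.integral_cong) (auto simp: std_normal_density_def scaleR_conv_of_real mult_ac)
    also have "\<dots> = complex_of_real (1 / sqrt (2 * pi)) * (\<integral>t. complex_of_real (exp (- t\<^sup>2 / 2)) *
        exp (- (\<i> * complex_of_real (t * r))) \<partial>lborel)"
      by (rule integral_mult_right_zero)
    finally have "complex_of_real (sqrt (2 * pi)) * complex_of_real (exp (- r\<^sup>2 / 2)) = 
        (complex_of_real (sqrt (2 * pi)) * complex_of_real (1 / sqrt (2 * pi))) * (\<integral>t. complex_of_real (exp (- t\<^sup>2 / 2)) *
        exp (- (\<i> * complex_of_real (t * r))) \<partial>lborel)" by (simp only: mult.assoc)
    moreover have "complex_of_real (sqrt (2 * pi)) * complex_of_real (1 / sqrt (2 * pi)) = 1"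
      by (simp flip: of_real_mult)
    ultimately show ?thesis by (simp only: of_real_mult mult_1_left)
  qed
  have sc: "complex_of_real (exp (- (a * t)\<^sup>2 / 2)) * exp (- (\<i> * complex_of_real (t * s))) =
      complex_of_real (exp (- (0 + a * t)\<^sup>2 / 2)) * exp (- (\<i> * complex_of_real ((0 + a * t) * (s / a))))" for t
    using assms by simp
  show ?I unfolding sc
    using lborel_integrable_real_affine[OF int0[of "s / a"], of a 0] assms by simp
  show ?V unfolding sc
    using lborel_integral_real_affine[of a "\<lambda>t. complex_of_real (exp (- t\<^sup>2 / 2)) * exp (- (\<i> * complex_of_real (t * (s / a))))" 0]
      assms unfolding val0 by (simp add: scaleR_conv_of_real field_simps)
qed

text \<open>Lebesgue measure is the image of a finite product of one-dimensional Lebesgue measures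
  under the coordinate map, so functions that factor over the coordinates reduce to Fubini. This
  brings Gaussians down to dimension one.\<close>

lemma
  fixes f :: "'a::euclidean_space \<Rightarrow> real \<Rightarrow> complex"
  assumes "\<And>b. b \<in> Basis \<Longrightarrow> integrable lborel (f b)"
  shows integrable_lborel_prod: "integrable lborel (\<lambda>x::'a. \<Prod>b\<in>Basis. f b (x \<bullet> b))"
    and integral_lborel_prod: "(\<integral>x. (\<Prod>b\<in>Basis. f b (x \<bullet> b)) \<partial>(lborel :: 'a measure)) = (\<Prod>b\<in>Basis. integral\<^sup>L lborel (f b))"
proof -
  interpret product_sigma_finite "\<lambda>_::'a. lborel :: real measure" ..
  have [measurable]: "\<And>b. b \<in> Basis \<Longrightarrow> f b \<in> borel_measurable borel"
    using assms borel_measurable_integrable by force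
  have eq: "lborel = distr (\<Pi>\<^sub>M b\<in>Basis. lborel) borel (\<lambda>x. \<Sum>b\<in>Basis. x b *\<^sub>R b :: 'a)"
    by (rule lborel_eq)
  have pe: "(\<Prod>b\<in>Basis. f b ((\<Sum>c\<in>Basis. x c *\<^sub>R c) \<bullet> b)) = (\<Prod>b\<in>Basis. f b (x b))" for x
    by (intro prod.cong) auto
  have meas: "(\<lambda>x. \<Sum>b\<in>Basis. x b *\<^sub>R b :: 'a) \<in> (\<Pi>\<^sub>M b\<in>Basis. lborel) \<rightarrow>\<^sub>M borel"
    by measurable
  have fm: "(\<lambda>x::'a. \<Prod>b\<in>Basis. f b (x \<bullet> b)) \<in> borel_measurable borel"
    by measurable
  have int: "integrable (\<Pi>\<^sub>M b\<in>Basis. lborel) (\<lambda>x. \<Prod>b\<in>Basis. f b (x b))"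
    using assms by (intro product_integrable_prod) auto
  show "integrable lborel (\<lambda>x::'a. \<Prod>b\<in>Basis. f b (x \<bullet> b))"
    unfolding eq integrable_distr_eq[OF meas fm] pe by (rule int)
  show "(\<integral>x. (\<Prod>b\<in>Basis. f b (x \<bullet> b)) \<partial>(lborel :: 'a measure)) = (\<Prod>b\<in>Basis. integral\<^sup>L lborel (f b))"
    unfolding eq integral_distr[OF meas fm] pe
    using assms by (intro product_integral_prod) auto
qed

section \<open>Gaussians and heat kernels\<close>

definition gaussian :: "real \<Rightarrow> real ^ 'n \<Rightarrow> real" where
  "gaussian a x = exp (- (a * norm x)\<^sup>2 / 2)"

text \<open>The centred normal density with standard deviation \<open>a\<close> in each coordinate,
  that is, the transform of \<open>gaussian a\<close> times the Fourier constant. Small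
  \<open>a\<close> means a flat Gaussian weight in frequency and a concentrated kernel in
  space.\<close>

definition heat_kernel :: "real \<Rightarrow> real ^ 'n \<Rightarrow> real" where
  "heat_kernel a x = fourier_const TYPE('n) * (1 / a) ^ CARD('n) * gaussian (1 / a) x"

lemma gaussian_pos: "0 < gaussian a x"
  by (simp add: gaussian_def)

lemma gaussian_le_1: "gaussian a x \<le> 1"
  by (simp add: gaussian_def)

lemma gaussian_continuous: "continuous_on UNIV (gaussian a)"
  unfolding gaussian_def by (intro continuous_intros) auto

lemma gaussian_borel [measurable]: "gaussian a \<in> borel_measurable borel"
  by (intro borel_measurable_continuous_onI gaussian_continuous)

lemma gaussian_phase_prod:
  "complex_of_real (gaussian a x) * phase x z =
    (\<Prod>b\<in>Basis. complex_of_real (exp (- (a * (x \<bullet> b))\<^sup>2 / 2)) * exp (- (\<i> * complex_of_real ((x \<bullet> b) * (z \<bullet> b)))))"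
proof -
  have "(\<Prod>b\<in>Basis. complex_of_real (exp (- (a * (x \<bullet> b))\<^sup>2 / 2))) = complex_of_real (gaussian a x)"
  proof -
    have "(a * norm x)\<^sup>2 = (\<Sum>b\<in>Basis. (a * (x \<bullet> b))\<^sup>2)"
      unfolding power_mult_distrib power2_norm_eq_inner euclidean_inner[of x x]
      by (simp add: sum_distrib_left power2_eq_square)
    then show ?thesis
      unfolding gaussian_def of_real_prod[symmetric]
      by (subst exp_sum[symmetric]) (auto simp: sum_negf sum_divide_distrib)
  qed
  moreover have "(\<Prod>b\<in>Basis. exp (- (\<i> * complex_of_real ((x \<bullet> b) * (z \<bullet> b))))) = phase x z"
    by (subst exp_sum[symmetric])
       (auto simp: euclidean_inner[of x z] sum_negf sum_distrib_left)
  ultimately show ?thesis by (simp add: prod.distrib)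
qed

lemma integrable_gaussian:
  assumes "0 < a"
  shows "integrable lebesgue (\<lambda>x. complex_of_real (gaussian a (x :: real ^ 'n)))"
proof -
  have "integrable lborel (\<lambda>x::real^'n. complex_of_real (gaussian a x) * phase x 0)"
    unfolding gaussian_phase_prod
    by (intro integrable_lborel_prod gaussian_fourier_real assms)
  then show ?thesis by (simp add: integrable_completion)
qed

lemma fourier_gaussian:
  assumes "0 < a"
  shows "fourier_L1 (\<lambda>x. complex_of_real (gaussian a x)) z =
    complex_of_real ((1 / a) ^ CARD('n) * gaussian (1 / a) (z :: real ^ 'n))"
proof -
  have "(\<integral>x. complex_of_real (gaussian a x) * phase x z \<partial>lebesgue) =
      (\<integral>x. complex_of_real (gaussian a x) * phase x z \<partial>lborel)"
    by (rule integral_completion) measurable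
  also have "\<dots> = (\<Prod>b\<in>(Basis :: (real ^ 'n) set). complex_of_real (sqrt (2 * pi) / a * exp (- ((z \<bullet> b) / a)\<^sup>2 / 2)))"
    unfolding gaussian_phase_prod
    by (subst integral_lborel_prod[OF gaussian_fourier_real(1)[OF assms]])
       (auto intro!: prod.cong simp only: gaussian_fourier_real(2)[OF assms])
  also have "\<dots> = complex_of_real ((sqrt (2 * pi) / a) ^ CARD('n)) * 
      (\<Prod>b\<in>(Basis :: (real ^ 'n) set). complex_of_real (exp (- (1 / a * (z \<bullet> b))\<^sup>2 / 2)))"
    by (simp only: of_real_mult prod.distrib) (simp add: power_divide)
  also have "(\<Prod>b\<in>(Basis :: (real ^ 'n) set). complex_of_real (exp (- (1 / a * (z \<bullet> b))\<^sup>2 / 2))) = complex_of_real (gaussian (1 / a) z)"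
    using gaussian_phase_prod[of "1 / a" z 0] by simp
  also have "complex_of_real ((sqrt (2 * pi) / a) ^ CARD('n)) =
      complex_of_real ((2 * pi) powr (real CARD('n) / 2) * (1 / a) ^ CARD('n))"
    by (simp add: power_divide powr_half_sqrt[symmetric] powr_power field_simps)
  finally have "fourier_L1 (\<lambda>x. complex_of_real (gaussian a x)) z =
      complex_of_real (fourier_const TYPE('n) * (2 * pi) powr (real CARD('n) / 2)) *
      complex_of_real ((1 / a) ^ CARD('n) * gaussian (1 / a) z)"
    unfolding fourier_L1_def by simp
  also have "fourier_const TYPE('n) * (2 * pi) powr (real CARD('n) / 2) = 1"
    by (simp add: powr_add[symmetric])
  finally show ?thesis by simp
qed

lemma heat_kernel_nonneg: "0 < a \<Longrightarrow> 0 \<le> heat_kernel a x"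
  by (simp add: heat_kernel_def gaussian_pos less_imp_le)

lemma heat_kernel_even: "heat_kernel a (- x) = heat_kernel a x"
  by (simp add: heat_kernel_def gaussian_def)

lemma heat_kernel_borel [measurable]: "heat_kernel a \<in> borel_measurable borel"
  unfolding heat_kernel_def by measurable

text \<open>The mass is read off from the transform of \<open>gaussian (1 / a)\<close> at frequency
  0.\<close>

lemma nn_integral_heat_kernel:
  assumes "0 < a"
  shows "(\<integral>\<^sup>+x. ennreal (heat_kernel a (x :: real ^ 'a)) \<partial>lborel) = 1"
proof -
  let ?c = "fourier_const TYPE('a) * (1 / a) ^ CARD('a)"
  have int: "integrable lborel (\<lambda>x::real^'a. complex_of_real (gaussian (1 / a) x))"
    using integrable_gaussian[of "1 / a"] assms by (simp add: integrable_completion)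
  have "complex_of_real (fourier_const TYPE('a)) * (\<integral>x. complex_of_real (gaussian (1 / a) (x :: real ^ 'a)) \<partial>lebesgue) = complex_of_real (a ^ CARD('a))"
    using fourier_gaussian[of "1 / a" "0 :: real ^ 'a"] assms by (simp add: fourier_L1_def gaussian_def)
  also have "(\<integral>x. complex_of_real (gaussian (1 / a) (x :: real ^ 'a)) \<partial>lebesgue) = complex_of_real (\<integral>x. gaussian (1 / a) (x :: real ^ 'a) \<partial>lborel)"
    by (subst integral_completion) auto
  finally have "fourier_const TYPE('a) * (\<integral>x. gaussian (1 / a) (x :: real ^ 'a) \<partial>lborel) = a ^ CARD('a)"
    unfolding of_real_mult[symmetric] of_real_eq_iff .
  then have *: "?c * (\<integral>x. gaussian (1 / a) (x :: real ^ 'a) \<partial>lborel) = 1"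
    using assms by (simp add: field_simps power_divide)
  have "integrable lborel (\<lambda>x::real^'a. gaussian (1 / a) x)"
    using int by (simp add: complex_of_real_integrable_eq)
  then have "(\<integral>\<^sup>+x. ennreal (heat_kernel a (x :: real ^ 'a)) \<partial>lborel) = ennreal (\<integral>x. heat_kernel a (x :: real ^ 'a) \<partial>lborel)"
    using assms by (intro nn_integral_eq_integral) (auto simp: heat_kernel_def heat_kernel_nonneg gaussian_pos less_imp_le)
  also have "(\<integral>x. heat_kernel a (x :: real ^ 'a) \<partial>lborel) = ?c * (\<integral>x. gaussian (1 / a) (x :: real ^ 'a) \<partial>lborel)"
    unfolding heat_kernel_def by (rule integral_mult_right_zero)
  finally show ?thesis using * by simp
qed

text \<open>The substitution \<open>y = x - a w\<close> moves the parameter out of the kernel and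
  into the argument of \<open>h\<close>; as \<open>a\<close> tends to 0,
  \<open>heat_kernel 1\<close> can then serve as a fixed dominating function.\<close>

lemma nn_integral_heat_kernel_conv:
  fixes h :: "real ^ 'n \<Rightarrow> ennreal"
  assumes [measurable]: "h \<in> borel_measurable borel" and a: "0 < a"
  shows "(\<integral>\<^sup>+y. ennreal (heat_kernel a (x - y)) * h y \<partial>lborel) =
    (\<integral>\<^sup>+w. ennreal (heat_kernel 1 w) * h (x - a *\<^sub>R w) \<partial>lborel)"
proof -
  have "(\<integral>\<^sup>+y. ennreal (heat_kernel a (x - y)) * h y \<partial>lborel) =
      (\<integral>\<^sup>+y. ennreal (heat_kernel a (x - y)) * h y \<partial>(density (distr lborel borel (\<lambda>w. x + (- a) *\<^sub>R w)) (\<lambda>_. \<bar>- a\<bar> ^ DIM(real ^ 'n))))"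
    using a by (subst lborel_affine[of "- a" x]) auto
  also have "\<dots> = (\<integral>\<^sup>+w. ennreal (a ^ CARD('n)) * (ennreal (heat_kernel a (x - (x + (- a) *\<^sub>R w))) * h (x + (- a) *\<^sub>R w)) \<partial>lborel)"
    using a by (simp add: nn_integral_density nn_integral_distr)
  also have "\<dots> = (\<integral>\<^sup>+w. ennreal (heat_kernel 1 w) * h (x - a *\<^sub>R w) \<partial>lborel)"
    using a by (intro nn_integral_cong)
      (simp add: mult.assoc[symmetric] ennreal_mult'[symmetric] heat_kernel_def gaussian_def power_divide)
  finally show ?thesis .
qed

text \<open>The product of the two completed sigma-algebras contains the Borel sets of the product
  space, so Borel functions of a pair are admissible in Fubini arguments over
  \<open>lebesgue\<close>.\<close>

lemma borel_measurable_pair_lebesgue: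
  fixes h :: "'a::euclidean_space \<Rightarrow> 'b::euclidean_space \<Rightarrow> 'c::topological_space"
  assumes "(\<lambda>p. h (fst p) (snd p)) \<in> borel_measurable borel"
  shows "(\<lambda>p. h (fst p) (snd p)) \<in> borel_measurable (lebesgue \<Otimes>\<^sub>M lebesgue)"
proof -
  have "(\<lambda>p. p) \<in> (lebesgue \<Otimes>\<^sub>M lebesgue) \<rightarrow>\<^sub>M (borel :: ('a \<times> 'b) measure)"
    using measurable_Pair[OF measurable_compose[OF measurable_fst ident_borel_measurable_lebesgue]
      measurable_compose[OF measurable_snd ident_borel_measurable_lebesgue]]
    by (simp add: borel_prod)
  from measurable_compose[OF this assms] show ?thesis by simp
qed

lemma heat_kernel_pair_measurable [measurable]:
  "(\<lambda>p. heat_kernel a (fst p - snd p)) \<in> borel_measurable (lebesgue \<Otimes>\<^sub>M lebesgue)"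
  unfolding heat_kernel_def gaussian_def
  by (intro borel_measurable_pair_lebesgue borel_measurable_continuous_onI continuous_intros) auto

lemma heat_kernel_diff_measurable [measurable]:
  "(\<lambda>y. heat_kernel a (x - y)) \<in> borel_measurable lebesgue"
  by (intro measurable_completion) measurable

lemma nn_integral_heat_kernel_diff:
  assumes "0 < a"
  shows "(\<integral>\<^sup>+y. ennreal (heat_kernel a (x - y)) \<partial>lebesgue) = 1"
proof -
  have "(\<lambda>x. ennreal (heat_kernel a x)) \<in> borel_measurable lebesgue"
    by (intro measurable_completion) measurable
  from nn_integral_lebesgue_reflect[OF this, of x] show ?thesis
    using nn_integral_heat_kernel[OF assms] by (simp add: nn_integral_completion)
qed

section \<open>The contraction inequality by Gaussian weights\<close>

lemma fourier_gaussian_modulated: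
  assumes "0 < a"
  shows "complex_of_real (fourier_const TYPE('n)) *
      fourier_L1 (\<lambda>\<xi>. complex_of_real (gaussian a \<xi>) * phase \<xi> (- x)) y =
    complex_of_real (heat_kernel a ((x :: real ^ 'n) - y))"
proof -
  have "fourier_L1 (\<lambda>\<xi>. complex_of_real (gaussian a \<xi>) * phase \<xi> (- x)) y =
      fourier_L1 (\<lambda>\<xi>. complex_of_real (gaussian a \<xi>)) (y - x)"
    unfolding fourier_L1_def
    using phase_add[of _ "- x" y] by (simp add: mult.assoc)
  then show ?thesis
    using heat_kernel_even[of a "x - y"]
    by (simp add: fourier_gaussian[OF assms] heat_kernel_def mult.assoc)
qed

text \<open>The weighted square is \<open>fourier_L1 f\<close> times \<open>\<phi>\<close>, where
  the Gaussian makes \<open>\<phi>\<close> integrable although \<open>fourier_L1 f\<close> is only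
  known to be bounded. The multiplication formula is used twice: once to move the transform from
  \<open>f\<close> to \<open>\<phi>\<close>, and once inside the transform of \<open>\<phi>\<close>,
  where the modulated Gaussian becomes a translated heat kernel.\<close>

lemma fourier_L1_gaussian_regularized:
  fixes f :: "real ^ 'n \<Rightarrow> complex"
  assumes f: "integrable lebesgue f" and a: "0 < a"
  shows "complex_of_real (\<integral>\<xi>. (norm (fourier_L1 f \<xi>))\<^sup>2 * gaussian a \<xi> \<partial>lebesgue) =
    (\<integral>x. f x * cnj (\<integral>y. f y * complex_of_real (heat_kernel a (x - y)) \<partial>lebesgue) \<partial>lebesgue)"
proof -
  define k where "k = complex_of_real (fourier_const TYPE('n))"
  define \<phi> where "\<phi> \<xi> = cnj (fourier_L1 f \<xi>) * complex_of_real (gaussian a \<xi>)" for \<xi>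
  have G: "integrable lebesgue (\<lambda>\<xi>::real^'n. complex_of_real (gaussian a \<xi>))"
    by (rule integrable_gaussian[OF a])
  have "(\<lambda>\<xi>. cnj (fourier_L1 f \<xi>)) \<in> L_infinity"
    using fourier_L1_L_infinity[OF f] by (auto simp: L_infinity_def intro: measurable_compose[OF _ borel_measurable_cnj])
  then have \<phi>: "integrable lebesgue \<phi>"
    unfolding \<phi>_def by (rule integrable_mult_L_infinity[OF G])
  have \<phi>_hat: "fourier_L1 \<phi> x = cnj (\<integral>y. f y * complex_of_real (heat_kernel a (x - y)) \<partial>lebesgue)" for x
  proof -
    let ?g = "\<lambda>\<xi>. complex_of_real (gaussian a \<xi>) * phase \<xi> (- x)"
    have "\<phi> \<xi> * phase \<xi> x = cnj (fourier_L1 f \<xi> * ?g \<xi>)" for \<xi>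
      using cnj_phase[of \<xi> "-x"] unfolding \<phi>_def by (simp del: exp_minus)
    then have "fourier_L1 \<phi> x = k * (\<integral>\<xi>. cnj (fourier_L1 f \<xi> * ?g \<xi>) \<partial>lebesgue)"
      unfolding fourier_L1_def[of \<phi>] k_def by (simp only:)
    also have "\<dots> = k * cnj (\<integral>\<xi>. fourier_L1 f \<xi> * ?g \<xi> \<partial>lebesgue)"
      by (subst Bochner_Integration.integral_cnj) (rule refl)
    also have "\<dots> = k * cnj (\<integral>y. f y * fourier_L1 ?g y \<partial>lebesgue)"
      by (subst fourier_L1_mult_formula[OF f integrable_mult_phase[OF G]]) (rule refl)
    also have "\<dots> = cnj (k * (\<integral>y. f y * fourier_L1 ?g y \<partial>lebesgue))"
      by (simp add: k_def)
    also have "k * (\<integral>y. f y * fourier_L1 ?g y \<partial>lebesgue) = (\<integral>y. k * (f y * fourier_L1 ?g y) \<partial>lebesgue)"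
      by (rule integral_mult_right_zero[symmetric])
    also have "(\<lambda>y. k * (f y * fourier_L1 ?g y)) = (\<lambda>y. f y * complex_of_real (heat_kernel a (x - y)))"
      unfolding fourier_gaussian_modulated[OF a, symmetric] k_def by (simp only: mult_ac)
    finally show ?thesis .
  qed
  have "complex_of_real (\<integral>\<xi>. (norm (fourier_L1 f \<xi>))\<^sup>2 * gaussian a \<xi> \<partial>lebesgue) =
      (\<integral>\<xi>. complex_of_real ((norm (fourier_L1 f \<xi>))\<^sup>2 * gaussian a \<xi>) \<partial>lebesgue)"
    by (rule integral_complex_of_real[symmetric])
  also have "\<dots> = (\<integral>\<xi>. fourier_L1 f \<xi> * \<phi> \<xi> \<partial>lebesgue)"
    by (simp only: \<phi>_def of_real_mult complex_norm_square mult.assoc)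
  also have "\<dots> = (\<integral>x. f x * fourier_L1 \<phi> x \<partial>lebesgue)"
    by (rule fourier_L1_mult_formula[OF f \<phi>])
  finally show ?thesis unfolding \<phi>_hat .
qed

lemma nn_integral_gaussian_regularized:
  fixes f :: "real ^ 'n \<Rightarrow> complex"
  assumes f: "integrable lebesgue f" and a: "0 < a"
  shows "(\<integral>\<^sup>+\<xi>. ennreal ((norm (fourier_L1 f \<xi>))\<^sup>2 * gaussian a \<xi>) \<partial>lebesgue) =
    ennreal (norm (\<integral>x. f x * cnj (\<integral>y. f y * complex_of_real (heat_kernel a (x - y)) \<partial>lebesgue) \<partial>lebesgue))"
proof -
  note fourier_L1_L_infinity[OF f]
  then have "integrable lebesgue (\<lambda>\<xi>. fourier_L1 f \<xi> * (fourier_L1 f \<xi> * complex_of_real (gaussian a \<xi>)))"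
    by (intro integrable_mult_L_infinity integrable_gaussian a)
  from integrable_norm[OF this]
  have "integrable lebesgue (\<lambda>\<xi>. (norm (fourier_L1 f \<xi>))\<^sup>2 * gaussian a \<xi>)"
    by (simp add: norm_mult power2_eq_square mult.assoc gaussian_pos less_imp_le)
  moreover have nn: "0 \<le> (norm (fourier_L1 f \<xi>))\<^sup>2 * gaussian a \<xi>" for \<xi>
    by (simp add: gaussian_pos less_imp_le)
  ultimately have "(\<integral>\<^sup>+\<xi>. ennreal ((norm (fourier_L1 f \<xi>))\<^sup>2 * gaussian a \<xi>) \<partial>lebesgue) =
      ennreal (\<integral>\<xi>. (norm (fourier_L1 f \<xi>))\<^sup>2 * gaussian a \<xi> \<partial>lebesgue)"
    by (intro nn_integral_eq_integral) auto
  also have "(\<integral>\<xi>. (norm (fourier_L1 f \<xi>))\<^sup>2 * gaussian a \<xi> \<partial>lebesgue) =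
     norm (complex_of_real (\<integral>\<xi>. (norm (fourier_L1 f \<xi>))\<^sup>2 * gaussian a \<xi> \<partial>lebesgue))"
    using nn by simp
  finally show ?thesis unfolding fourier_L1_gaussian_regularized[OF f a] .
qed

lemma norm_integral_le_nn_integral:
  fixes f :: "'a \<Rightarrow> 'b::{banach, second_countable_topology}"
  shows "ennreal (norm (integral\<^sup>L M f)) \<le> (\<integral>\<^sup>+x. ennreal (norm (f x)) \<partial>M)"
  by (cases "integrable M f") (auto intro: integral_norm_bound_ennreal simp: not_integrable_integral_eq)

text \<open>Schur's test: bound \<open>|f x| |f y|\<close> by half the sum of the squares. The heat
  kernel is even and has mass 1 in either variable, so each of the two resulting double integrals
  equals \<open>L2_norm_sq f\<close>.\<close>

lemma gaussian_regularized_le: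
  fixes f :: "real ^ 'n \<Rightarrow> complex"
  assumes f: "integrable lebesgue f" and a: "0 < a"
  shows "(\<integral>\<^sup>+\<xi>. ennreal ((norm (fourier_L1 f \<xi>))\<^sup>2 * gaussian a \<xi>) \<partial>lebesgue) \<le> L2_norm_sq f"
proof -
  have [measurable]: "f \<in> borel_measurable lebesgue" using f by auto
  let ?h = "\<lambda>x y. ennreal (heat_kernel a (x - y))"
  let ?n = "\<lambda>x. ennreal ((norm (f x))\<^sup>2)"
  have h0: "0 \<le> heat_kernel a x" for x :: "real ^ 'n" by (rule heat_kernel_nonneg[OF a])
  have "(\<integral>\<^sup>+\<xi>. ennreal ((norm (fourier_L1 f \<xi>))\<^sup>2 * gaussian a \<xi>) \<partial>lebesgue) \<le>
      (\<integral>\<^sup>+x. ennreal (norm (f x)) * ennreal (norm (\<integral>y. f y * complex_of_real (heat_kernel a (x - y)) \<partial>lebesgue)) \<partial>lebesgue)"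
    unfolding nn_integral_gaussian_regularized[OF f a]
    by (rule order_trans[OF norm_integral_le_nn_integral]) (simp add: norm_mult ennreal_mult)
  also have "\<dots> \<le> (\<integral>\<^sup>+x. ennreal (norm (f x)) * (\<integral>\<^sup>+y. ennreal (norm (f y * complex_of_real (heat_kernel a (x - y)))) \<partial>lebesgue) \<partial>lebesgue)"
    by (intro nn_integral_mono mult_left_mono norm_integral_le_nn_integral) auto
  also have "\<dots> = (\<integral>\<^sup>+x. \<integral>\<^sup>+y. ennreal (norm (f x)) * ennreal (norm (f y * complex_of_real (heat_kernel a (x - y)))) \<partial>lebesgue \<partial>lebesgue)"
    by (subst nn_integral_cmult) auto
  also have "\<dots> \<le> (\<integral>\<^sup>+x. \<integral>\<^sup>+y. ennreal (1/2) * (?n x * ?h x y + ?n y * ?h x y) \<partial>lebesgue \<partial>lebesgue)"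
  proof (intro nn_integral_mono)
    fix x y
    have *: "norm (f x) * (norm (f y) * heat_kernel a (x - y)) \<le>
        1/2 * ((norm (f x))\<^sup>2 * heat_kernel a (x - y) + (norm (f y))\<^sup>2 * heat_kernel a (x - y))"
      using mult_right_mono[OF sum_squares_bound[of "norm (f x)" "norm (f y)"] h0[of "x - y"]]
      by (simp add: algebra_simps)
    show "ennreal (norm (f x)) * ennreal (norm (f y * complex_of_real (heat_kernel a (x - y)))) \<le>
        ennreal (1/2) * (?n x * ?h x y + ?n y * ?h x y)"
      using ennreal_leI[OF *] h0[of "x - y"]
      by (simp only: norm_mult ennreal_mult ennreal_plus mult_nonneg_nonneg add_nonneg_nonneg zero_le_power2
          norm_ge_zero norm_of_real abs_of_nonneg divide_nonneg_nonneg zero_le_one zero_le_numeral)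
  qed
  also have "\<dots> = ennreal (1/2) * ((\<integral>\<^sup>+x. \<integral>\<^sup>+y. ?n x * ?h x y \<partial>lebesgue \<partial>lebesgue) + (\<integral>\<^sup>+x. \<integral>\<^sup>+y. ?n y * ?h x y \<partial>lebesgue \<partial>lebesgue))"
    by (simp add: nn_integral_cmult nn_integral_add)
  also have "(\<integral>\<^sup>+x. \<integral>\<^sup>+y. ?n x * ?h x y \<partial>lebesgue \<partial>lebesgue) = L2_norm_sq f"
    by (simp add: nn_integral_cmult nn_integral_heat_kernel_diff[OF a] L2_norm_sq_def)
  also have "(\<integral>\<^sup>+x. \<integral>\<^sup>+y. ?n y * ?h x y \<partial>lebesgue \<partial>lebesgue) = (\<integral>\<^sup>+y. \<integral>\<^sup>+x. ?n y * ?h x y \<partial>lebesgue \<partial>lebesgue)"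
  proof (rule lebesgue_pair.Fubini'[symmetric])
    have "(\<lambda>(x, y). ?n y * ?h x y) = (\<lambda>p. ?n (snd p) * ?h (fst p) (snd p))" by auto
    then show "(\<lambda>(x, y). ?n y * ?h x y) \<in> borel_measurable (lebesgue \<Otimes>\<^sub>M lebesgue)"
      by simp
  qed
  also have "\<dots> = (\<integral>\<^sup>+y. \<integral>\<^sup>+x. ?n y * ?h y x \<partial>lebesgue \<partial>lebesgue)"
  proof (intro nn_integral_cong)
    fix x y show "?n y * ?h x y = ?n y * ?h y x"
      using heat_kernel_even[of a "x - y"] by simp
  qed
  also have "\<dots> = L2_norm_sq f"
    by (simp add: nn_integral_cmult nn_integral_heat_kernel_diff[OF a] L2_norm_sq_def)
  also have "ennreal (1/2) * (L2_norm_sq f + L2_norm_sq f) = L2_norm_sq f"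
  proof -
    have "ennreal (1/2) * 2 = ennreal (1/2 * 2)" by (subst ennreal_mult) auto
    then show ?thesis unfolding mult_2[symmetric] mult.assoc[symmetric] by (simp only:) simp
  qed
  finally show ?thesis .
qed

text \<open>Fatou's lemma, the weights tending to 1 pointwise.\<close>

lemma L2_norm_sq_le_liminf_gaussian:
  assumes f: "F \<in> borel_measurable lebesgue"
  shows "L2_norm_sq F \<le> liminf (\<lambda>n. \<integral>\<^sup>+\<xi>. ennreal ((norm (F \<xi>))\<^sup>2 * gaussian (1 / Suc n) \<xi>) \<partial>lebesgue)"
proof -
  note [measurable] = f
  have [measurable]: "gaussian a \<in> borel_measurable lebesgue" for a
    by (intro measurable_completion) measurable
  have "L2_norm_sq F = (\<integral>\<^sup>+\<xi>. liminf (\<lambda>n. ennreal ((norm (F \<xi>))\<^sup>2 * gaussian (1 / Suc n) \<xi>)) \<partial>lebesgue)"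
    unfolding L2_norm_sq_def
  proof (rule nn_integral_cong)
    fix \<xi> :: "real ^ 'a"
    have "(\<lambda>n. ennreal ((norm (F \<xi>))\<^sup>2 * gaussian (1 / Suc n) \<xi>)) \<longlonglongrightarrow>
        ennreal ((norm (F \<xi>))\<^sup>2 * exp (- (0 * norm \<xi>)\<^sup>2 / 2))"
      unfolding gaussian_def
      by (intro tendsto_intros filterlim_compose[OF LIMSEQ_inverse_real_of_nat, simplified] LIMSEQ_Suc lim_1_over_n) auto
    from lim_imp_Liminf[OF _ this]
    show "ennreal ((norm (F \<xi>))\<^sup>2) = liminf (\<lambda>n. ennreal ((norm (F \<xi>))\<^sup>2 * gaussian (1 / Suc n) \<xi>))"
      by simp
  qed
  also have "\<dots> \<le> liminf (\<lambda>n. \<integral>\<^sup>+\<xi>. ennreal ((norm (F \<xi>))\<^sup>2 * gaussian (1 / Suc n) \<xi>) \<partial>lebesgue)"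
    by (rule nn_integral_liminf) measurable
  finally show ?thesis .
qed

lemma L2_norm_sq_fourier_L1_le:
  assumes f: "integrable lebesgue f"
  shows "L2_norm_sq (fourier_L1 f) \<le> L2_norm_sq f"
proof -
  have "liminf (\<lambda>n. \<integral>\<^sup>+\<xi>. ennreal ((norm (fourier_L1 f \<xi>))\<^sup>2 * gaussian (1 / Suc n) \<xi>) \<partial>lebesgue) \<le> L2_norm_sq f"
    by (intro Liminf_le always_eventually allI gaussian_regularized_le[OF f]) auto
  with L2_norm_sq_le_liminf_gaussian[OF fourier_L1_measurable[OF f]] show ?thesis
    by (rule order_trans)
qed

lemma fourier_L1_in_L2: "integrable lebesgue f \<Longrightarrow> f \<in> L2 \<Longrightarrow> fourier_L1 f \<in> L2"
  by (intro L2_I fourier_L1_measurable)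
     (auto intro: le_less_trans[OF L2_norm_sq_fourier_L1_le] L2_norm_sq_finite)

section \<open>Plancherel's theorem\<close>

lemma L2_indicator:
  assumes "A \<in> lmeasurable"
  shows "indicator A \<in> L2" "integrable lebesgue (indicator A :: real ^ 'n \<Rightarrow> complex)"
    "L2_norm_sq (indicator A :: real ^ 'n \<Rightarrow> complex) = emeasure lebesgue A"
proof -
  have A: "A \<in> sets lebesgue" "emeasure lebesgue A < \<infinity>"
    using assms by (auto simp: fmeasurable_def)
  have "(norm (indicator A x :: complex))\<^sup>2 = indicator A x" for x
    by (simp add: indicator_def)
  then show "L2_norm_sq (indicator A :: real ^ 'n \<Rightarrow> complex) = emeasure lebesgue A"
    using A by (simp add: L2_norm_sq_def ennreal_indicator del: emeasure_completion)
  then show "indicator A \<in> L2"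
    using A by (intro L2_I) auto
  show "integrable lebesgue (indicator A :: real ^ 'n \<Rightarrow> complex)"
  proof -
    have "integrable lebesgue (\<lambda>x. complex_of_real (indicator A x))"
      using integrable_real_indicator[OF A] by (rule integrable_of_real)
    also have "(\<lambda>x. complex_of_real (indicator A x)) = indicator A"
      by (auto simp: indicator_def)
    finally show ?thesis .
  qed
qed

text \<open>For an indicator the regularized inner product is real and nonnegative, so it can be
  written with extended-valued integrals and nothing is lost in an estimate. The inner integral is
  the probability that \<open>x\<close>, displaced by \<open>a\<close> times a standard normal
  vector, still lies in \<open>U\<close>.\<close>

lemma nn_integral_gaussian_indicator:
  fixes U :: "(real ^ 'n) set"
  assumes U: "open U" "U \<in> lmeasurable" and a: "0 < a"
  shows "(\<integral>\<^sup>+\<xi>. ennreal ((norm (fourier_L1 (indicator U) \<xi>))\<^sup>2 * gaussian a \<xi>) \<partial>lebesgue) =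
    (\<integral>\<^sup>+x. indicator U x * (\<integral>\<^sup>+w. ennreal (heat_kernel 1 w) * indicator U (x - a *\<^sub>R w) \<partial>lborel) \<partial>lebesgue)"
proof -
  define p where "p x = (\<integral>y. indicator U y * heat_kernel a (x - y) \<partial>lebesgue)" for x
  have [measurable]: "U \<in> sets borel" using U by simp
  have U1: "integrable lebesgue (indicator U :: real ^ 'n \<Rightarrow> real)"
    using U by (simp add: integrable_indicator_iff fmeasurable_def del: emeasure_completion)
  have h0: "0 \<le> heat_kernel a x" for x :: "real ^ 'n" by (rule heat_kernel_nonneg[OF a])
  have meas: "(\<lambda>p. indicator U (snd p) * heat_kernel a (fst p - snd p)) \<in> borel_measurable (lebesgue \<Otimes>\<^sub>M lebesgue)"
  proof (rule borel_measurable_times)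
    show "(\<lambda>p. indicator U (snd p)) \<in> borel_measurable (lebesgue \<Otimes>\<^sub>M lebesgue)"
      using U by (intro measurable_compose[OF measurable_snd]) (auto intro: borel_measurable_integrable[OF U1])
  qed measurable
  have int: "integrable lebesgue (\<lambda>y. indicator U y * heat_kernel a (x - y))" for x
  proof (rule integrableI_bounded)
    have "(\<integral>\<^sup>+y. ennreal (norm (indicator U y * heat_kernel a (x - y))) \<partial>lebesgue) \<le> (\<integral>\<^sup>+y. ennreal (heat_kernel a (x - y)) \<partial>lebesgue)"
      using h0 by (intro nn_integral_mono) (auto simp: indicator_def)
    then show "(\<integral>\<^sup>+y. ennreal (norm (indicator U y * heat_kernel a (x - y))) \<partial>lebesgue) < \<infinity>"
      unfolding nn_integral_heat_kernel_diff[OF a] by (rule le_less_trans) simp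
  qed (use borel_measurable_integrable[OF U1] in measurable)
  have p0: "0 \<le> p x" for x
    unfolding p_def using h0 by (intro integral_nonneg_AE) (auto simp: indicator_def)
  have p: "ennreal (p x) = (\<integral>\<^sup>+w. ennreal (heat_kernel 1 w) * indicator U (x - a *\<^sub>R w) \<partial>lborel)" for x
  proof -
    have "ennreal (p x) = (\<integral>\<^sup>+y. ennreal (indicator U y * heat_kernel a (x - y)) \<partial>lebesgue)"
      unfolding p_def using int h0 by (intro nn_integral_eq_integral[symmetric]) auto
    also have "\<dots> = (\<integral>\<^sup>+y. ennreal (heat_kernel a (x - y)) * indicator U y \<partial>lborel)"
      unfolding nn_integral_completion by (intro nn_integral_cong) (auto simp: indicator_def)
    also have "\<dots> = (\<integral>\<^sup>+w. ennreal (heat_kernel 1 w) * indicator U (x - a *\<^sub>R w) \<partial>lborel)"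
      by (rule nn_integral_heat_kernel_conv[OF _ a]) measurable
    finally show ?thesis .
  qed
  have p1: "p x \<le> 1" for x
  proof -
    have "ennreal (p x) \<le> (\<integral>\<^sup>+w. ennreal (heat_kernel 1 (w :: real ^ 'n)) \<partial>lborel)"
      unfolding p by (intro nn_integral_mono) (auto simp: indicator_def)
    then show ?thesis by (simp add: nn_integral_heat_kernel)
  qed
  have pm: "p \<in> borel_measurable lebesgue"
    unfolding p_def[abs_def]
    by (rule lebesgue.borel_measurable_lebesgue_integral) (use meas in \<open>simp add: case_prod_beta\<close>)
  have int2: "integrable lebesgue (\<lambda>x. indicator U x * p x)"
    by (rule Bochner_Integration.integrable_bound[OF U1])
       (use p0 p1 in \<open>auto simp: indicator_def intro!: borel_measurable_times[OF borel_measurable_integrable[OF U1] pm, unfolded indicator_def]\<close>)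
  have "(\<integral>x. indicator U x * cnj (\<integral>y. indicator U y * complex_of_real (heat_kernel a (x - y)) \<partial>lebesgue) \<partial>lebesgue) =
     complex_of_real (\<integral>x. indicator U x * p x \<partial>lebesgue)"
  proof -
    have "indicator U y * complex_of_real (heat_kernel a (x - y)) = complex_of_real (indicator U y * heat_kernel a (x - y))" for x y
      by (simp add: indicator_def)
    moreover have "indicator U x * cnj (complex_of_real (p x)) = complex_of_real (indicator U x * p x)" for x
      by (simp add: indicator_def)
    ultimately show ?thesis by (simp only: integral_complex_of_real p_def[symmetric])
  qed
  moreover have i0: "0 \<le> (\<integral>x. indicator U x * p x \<partial>lebesgue)"
    using p0 by (intro integral_nonneg_AE) (auto simp: indicator_def)
  ultimately have "(\<integral>\<^sup>+\<xi>. ennreal ((norm (fourier_L1 (indicator U) \<xi>))\<^sup>2 * gaussian a \<xi>) \<partial>lebesgue) =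
      ennreal (\<integral>x. indicator U x * p x \<partial>lebesgue)"
    by (subst nn_integral_gaussian_regularized[OF L2_indicator(2)[OF U(2)] a]) simp
  also have "\<dots> = (\<integral>\<^sup>+x. ennreal (indicator U x * p x) \<partial>lebesgue)"
    using int2 p0 by (intro nn_integral_eq_integral[symmetric]) auto
  also have "\<dots> = (\<integral>\<^sup>+x. indicator U x * ennreal (p x) \<partial>lebesgue)"
    by (intro nn_integral_cong) (auto simp: indicator_def)
  finally show ?thesis unfolding p .
qed

text \<open>For \<open>x\<close> in the open set \<open>U\<close> the smoothed indicator tends to 1, so no continuity of
  translations is needed.\<close>

lemma plancherel_open:
  fixes U :: "(real ^ 'n) set"
  assumes U: "open U" "U \<in> lmeasurable"
  shows "L2_norm_sq (fourier_L1 (indicator U)) = L2_norm_sq (indicator U :: real ^ 'n \<Rightarrow> complex)"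
proof (rule antisym)
  show "L2_norm_sq (fourier_L1 (indicator U)) \<le> L2_norm_sq (indicator U :: real ^ 'n \<Rightarrow> complex)"
    by (rule L2_norm_sq_fourier_L1_le[OF L2_indicator(2)[OF U(2)]])
  have [measurable]: "U \<in> sets borel" using U by simp
  define q where "q n x = (\<integral>\<^sup>+w. ennreal (heat_kernel 1 w) * indicator U (x - (1 / Suc n) *\<^sub>R w) \<partial>lborel)"
    for n x
  have q: "(\<lambda>n. q n x) \<longlonglongrightarrow> 1" if x: "x \<in> U" for x
  proof -
    have "(\<lambda>n. q n x) \<longlonglongrightarrow> (\<integral>\<^sup>+w. ennreal (heat_kernel 1 (w :: real ^ 'n)) \<partial>lborel)"
      unfolding q_def
    proof (rule nn_integral_dominated_convergence[where w = "\<lambda>w. ennreal (heat_kernel 1 w)"])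
      show "AE w in lborel. (\<lambda>n. ennreal (heat_kernel 1 w) * indicator U (x - (1 / Suc n) *\<^sub>R w)) \<longlonglongrightarrow> ennreal (heat_kernel 1 w)"
      proof (intro AE_I2)
        fix w :: "real ^ 'n"
        have "(\<lambda>n. x - (1 / Suc n) *\<^sub>R w) \<longlonglongrightarrow> x - 0 *\<^sub>R w"
          by (intro tendsto_intros LIMSEQ_Suc lim_1_over_n)
        then have "\<forall>\<^sub>F n in sequentially. x - (1 / Suc n) *\<^sub>R w \<in> U"
          using U x by (intro topological_tendstoD[where l = x]) auto
        then show "(\<lambda>n. ennreal (heat_kernel 1 w) * indicator U (x - (1 / Suc n) *\<^sub>R w)) \<longlonglongrightarrow> ennreal (heat_kernel 1 w)"
          by (intro tendsto_eventually) (auto elim: eventually_mono)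
      qed
      show "AE w in lborel. ennreal (heat_kernel 1 w) * indicator U (x - (1 / Suc n) *\<^sub>R w) \<le> ennreal (heat_kernel 1 w)" for n
        by (auto simp: indicator_def)
    qed (auto simp: nn_integral_heat_kernel)
    then show ?thesis by (simp add: nn_integral_heat_kernel)
  qed
  have qm: "q n \<in> borel_measurable lebesgue" for n
  proof -
    have "q n \<in> borel_measurable borel"
      unfolding q_def[abs_def] by (rule lborel.borel_measurable_nn_integral) measurable
    then show ?thesis by (intro measurable_completion) simp
  qed
  have "L2_norm_sq (indicator U :: real ^ 'n \<Rightarrow> complex) = (\<integral>\<^sup>+x. indicator U x \<partial>lebesgue)"
    using U by (simp add: L2_indicator nn_integral_indicator fmeasurable_def del: emeasure_completion)
  also have "\<dots> = (\<integral>\<^sup>+x. liminf (\<lambda>n. indicator U x * q n x) \<partial>lebesgue)"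
  proof (rule nn_integral_cong)
    fix x show "indicator U x = liminf (\<lambda>n. indicator U x * q n x)"
      using lim_imp_Liminf[OF _ q[of x]] by (auto simp: indicator_def Liminf_const)
  qed
  also have "\<dots> \<le> liminf (\<lambda>n. \<integral>\<^sup>+x. indicator U x * q n x \<partial>lebesgue)"
    using qm U by (intro nn_integral_liminf borel_measurable_times_ennreal borel_measurable_indicator) auto
  also have "\<dots> = liminf (\<lambda>n. \<integral>\<^sup>+\<xi>. ennreal ((norm (fourier_L1 (indicator U) \<xi>))\<^sup>2 * gaussian (1 / Suc n) \<xi>) \<partial>lebesgue)"
    unfolding q_def by (subst nn_integral_gaussian_indicator[OF U]) auto
  also have "\<dots> \<le> L2_norm_sq (fourier_L1 (indicator U))"
    unfolding L2_norm_sq_def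
    by (intro Liminf_le always_eventually allI nn_integral_mono ennreal_leI mult_left_le) (auto simp: gaussian_le_1)
  finally show "L2_norm_sq (indicator U :: real ^ 'n \<Rightarrow> complex) \<le> L2_norm_sq (fourier_L1 (indicator U))" .
qed

text \<open>By the contraction inequality the transforms converge in L2 along with the functions,
  and the squared norm is continuous on both sides.\<close>

lemma plancherel_closed:
  assumes f: "integrable lebesgue f" "f \<in> L2"
    and u: "\<And>n. integrable lebesgue (u n)" "\<And>n. u n \<in> L2"
    and iso: "\<And>n. L2_norm_sq (fourier_L1 (u n)) = L2_norm_sq (u n)"
    and lim: "(\<lambda>n. L2_norm_sq (\<lambda>x. u n x - f x)) \<longlonglongrightarrow> 0"
  shows "L2_norm_sq (fourier_L1 f) = L2_norm_sq f"
proof -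
  have "(\<lambda>n. L2_norm_sq (\<lambda>\<xi>. fourier_L1 (u n) \<xi> - fourier_L1 f \<xi>)) \<longlonglongrightarrow> 0"
  proof (rule tendsto_sandwich[OF _ _ tendsto_const lim])
    show "\<forall>\<^sub>F n in sequentially. L2_norm_sq (\<lambda>\<xi>. fourier_L1 (u n) \<xi> - fourier_L1 f \<xi>) \<le> L2_norm_sq (\<lambda>x. u n x - f x)"
      unfolding fourier_L1_diff[OF u(1) f(1), symmetric]
      using f u by (intro always_eventually allI L2_norm_sq_fourier_L1_le) auto
  qed auto
  from L2_norm_sq_tendsto[OF _ _ this] have "(\<lambda>n. L2_norm_sq (u n)) \<longlonglongrightarrow> L2_norm_sq (fourier_L1 f)"
    using f u by (simp add: iso fourier_L1_in_L2)
  moreover have "(\<lambda>n. L2_norm_sq (u n)) \<longlonglongrightarrow> L2_norm_sq f"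
    by (rule L2_norm_sq_tendsto[OF u(2) f(2) lim])
  ultimately show ?thesis by (rule LIMSEQ_unique)
qed

text \<open>The defect \<open>\<parallel>f\<parallel>\<^sup>2 - \<parallel>Ff\<parallel>\<^sup>2\<close> is a positive semidefinite quadratic form, so its zeros form
  a subspace.\<close>

lemma plancherel_add:
  assumes f: "integrable lebesgue f" "f \<in> L2" and g: "integrable lebesgue g" "g \<in> L2"
    and iso: "L2_norm_sq (fourier_L1 f) = L2_norm_sq f" "L2_norm_sq (fourier_L1 g) = L2_norm_sq g"
  shows "L2_norm_sq (fourier_L1 (\<lambda>x. f x + g x)) = L2_norm_sq (\<lambda>x. f x + g x)"
proof (rule antisym)
  let ?p = "\<lambda>x. f x + g x" and ?m = "\<lambda>x. f x - g x"
  have int: "integrable lebesgue ?p" "integrable lebesgue ?m" using f g by auto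
  show "L2_norm_sq (fourier_L1 ?p) \<le> L2_norm_sq ?p" by (rule L2_norm_sq_fourier_L1_le[OF int(1)])
  have "L2_norm_sq ?p + L2_norm_sq ?m = L2_norm_sq (fourier_L1 ?p) + L2_norm_sq (fourier_L1 ?m)"
    using L2_norm_sq_parallelogram[of f g] L2_norm_sq_parallelogram[of "fourier_L1 f" "fourier_L1 g"] iso f g
    unfolding fourier_L1_add[OF f(1) g(1), symmetric] fourier_L1_diff[OF f(1) g(1), symmetric]
    by (simp add: L2_measurable fourier_L1_measurable)
  also have "\<dots> \<le> L2_norm_sq (fourier_L1 ?p) + L2_norm_sq ?m"
    by (intro add_left_mono L2_norm_sq_fourier_L1_le[OF int(2)])
  finally show "L2_norm_sq ?p \<le> L2_norm_sq (fourier_L1 ?p)"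
    using L2_norm_sq_finite[OF L2_diff[OF f(2) g(2)]] by (auto simp: add.commute[of _ "L2_norm_sq (\<lambda>x. f x - g x)"] ennreal_add_left_cancel_le)
qed

lemma plancherel_sum:
  assumes "finite I" "\<And>i. i \<in> I \<Longrightarrow> integrable lebesgue (f i)" "\<And>i. i \<in> I \<Longrightarrow> f i \<in> L2"
    "\<And>i. i \<in> I \<Longrightarrow> L2_norm_sq (fourier_L1 (f i)) = L2_norm_sq (f i)"
  shows "(\<lambda>x. \<Sum>i\<in>I. f i x) \<in> L2 \<and> L2_norm_sq (fourier_L1 (\<lambda>x. \<Sum>i\<in>I. f i x)) = L2_norm_sq (\<lambda>x. \<Sum>i\<in>I. f i x)"
  using assms
proof (induction I rule: finite_induct)
  case empty
  then show ?case by (auto simp: L2_iff L2_norm_sq_def fourier_L1_def)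
next
  case (insert i I)
  then show ?case by (auto intro!: L2_add plancherel_add)
qed

text \<open>Outer regularity: open supersets \<open>U n\<close> exceed \<open>A\<close> by a set of
  measure below \<open>1 / Suc n\<close>, and the measure of the excess is exactly the squared
  distance between the indicators.\<close>

lemma plancherel_indicator:
  fixes A :: "(real ^ 'n) set"
  assumes A: "A \<in> lmeasurable"
  shows "L2_norm_sq (fourier_L1 (indicator A)) = L2_norm_sq (indicator A :: real ^ 'n \<Rightarrow> complex)"
proof -
  have "\<exists>U. open U \<and> A \<subseteq> U \<and> U - A \<in> lmeasurable \<and> emeasure lebesgue (U - A) < ennreal (1 / Suc n)" for n
    using sets_lebesgue_outer_open[OF fmeasurableD[OF A], of "1 / Suc n"] by (metis zero_less_divide_1_iff of_nat_0_less_iff zero_less_Suc)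
  then obtain U where U: "\<And>n. open (U n)" "\<And>n. A \<subseteq> U n" "\<And>n. U n - A \<in> lmeasurable"
    "\<And>n::nat. emeasure lebesgue (U n - A) < ennreal (1 / Suc n)" by metis
  have Um: "U n \<in> lmeasurable" for n
    using fmeasurable.Un[OF A U(3)[of n]] U(2)[of n] by (simp add: Un_absorb1)
  show ?thesis
  proof (rule plancherel_closed[where u = "\<lambda>n. indicator (U n)"])
    have "(\<lambda>x. indicator (U n) x - indicator A x) = (indicator (U n - A) :: real ^ 'n \<Rightarrow> complex)" for n
      using U(2)[of n] by (auto simp: indicator_def fun_eq_iff)
    then have eq: "L2_norm_sq (\<lambda>x. indicator (U n) x - indicator A x :: complex) = emeasure lebesgue (U n - A)" for n
      by (simp add: L2_indicator(3)[OF U(3)] del: emeasure_completion)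
    show "(\<lambda>n. L2_norm_sq (\<lambda>x. indicator (U n) x - indicator A x :: complex)) \<longlonglongrightarrow> 0"
    proof (rule tendsto_sandwich[OF _ _ tendsto_const])
      have "(\<lambda>n. ennreal (1 / Suc n)) \<longlonglongrightarrow> ennreal 0"
        by (intro tendsto_ennrealI LIMSEQ_Suc lim_1_over_n)
      then show "(\<lambda>n. ennreal (1 / Suc n)) \<longlonglongrightarrow> 0" by simp
    qed (use U(4) in \<open>auto simp: eq less_imp_le simp del: emeasure_completion\<close>)
  qed (use U A Um in \<open>auto intro: L2_indicator plancherel_open\<close>)
qed

lemma plancherel_simple:
  assumes s: "simple_function lebesgue s" and int: "integrable lebesgue s"
  shows "s \<in> L2 \<and> L2_norm_sq (fourier_L1 s) = L2_norm_sq s"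
proof -
  \<comment> \<open>The level set of 0 may have infinite measure and contributes nothing to the sum;
    the other level sets have finite measure by Markov's inequality.\<close>
  define I where "I = range s - {0}"
  have I: "finite I" using s by (simp add: I_def simple_function_def)
  have m: "s -` {c} \<in> lmeasurable" if "c \<in> I" for c
  proof -
    have "s -` {c} \<in> sets lebesgue"
      using simple_functionD(2)[OF s, of "{c}"] by simp
    moreover have "emeasure lebesgue (s -` {c}) < \<infinity>"
    proof -
      have "ennreal (norm c) * emeasure lebesgue (s -` {c}) = (\<integral>\<^sup>+x. ennreal (norm c) * indicator (s -` {c}) x \<partial>lebesgue)"
        using calculation by (simp add: nn_integral_cmult_indicator del: emeasure_completion)
      also have "\<dots> \<le> (\<integral>\<^sup>+x. ennreal (norm (s x)) \<partial>lebesgue)"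
        by (intro nn_integral_mono) (auto simp: indicator_def)
      also have "\<dots> < \<infinity>" using int by (simp add: integrable_iff_bounded)
      finally show ?thesis using that by (auto simp: ennreal_mult_less_top I_def simp del: emeasure_completion)
    qed
    ultimately show ?thesis by (simp add: fmeasurable_def del: emeasure_completion)
  qed
  have eq: "s = (\<lambda>x. \<Sum>c\<in>I. c * indicator (s -` {c}) x)"
  proof
    fix x
    have "(\<Sum>c\<in>I. c * indicator (s -` {c}) x) = (\<Sum>c\<in>I. if c = s x then s x else 0)"
      by (intro sum.cong) (auto simp: indicator_def)
    also have "\<dots> = s x" using I by (auto simp: I_def)
    finally show "s x = (\<Sum>c\<in>I. c * indicator (s -` {c}) x)" ..
  qed
  have "L2_norm_sq (fourier_L1 (\<lambda>x. c * indicator (s -` {c}) x)) = L2_norm_sq (\<lambda>x. c * indicator (s -` {c}) x)" if "c \<in> I" for c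
    unfolding fourier_L1_cmult[abs_def]
    using L2_indicator[OF m[OF that]] plancherel_indicator[OF m[OF that]]
    by (subst (1 2) L2_norm_sq_cmult) (auto intro: fourier_L1_measurable)
  then show ?thesis
    by (subst (1 2 3) eq, intro plancherel_sum I) (auto intro: L2_cmult L2_indicator m)
qed

theorem plancherel_L1:
  assumes f: "integrable lebesgue f" "f \<in> L2"
  shows "L2_norm_sq (fourier_L1 f) = L2_norm_sq f"
proof -
  have [measurable]: "f \<in> borel_measurable lebesgue" using f by auto
  obtain s where s: "\<And>i. simple_function lebesgue (s i)" "\<And>x. (\<lambda>i. s i x) \<longlonglongrightarrow> f x"
      "\<And>i x. norm (s i x) \<le> 2 * norm (f x)"
    using borel_measurable_implies_sequence_metric[of f lebesgue 0] by (auto simp: dist_norm)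
  have [measurable]: "s i \<in> borel_measurable lebesgue" for i
    using s(1) by (rule borel_measurable_simple_function)
  have int: "integrable lebesgue (s i)" for i
    by (rule Bochner_Integration.integrable_bound[of _ "\<lambda>x. 2 * f x"]) (use f s in \<open>auto simp: norm_mult\<close>)
  show ?thesis
  proof (rule plancherel_closed[where u = s])
    have "(\<lambda>n. L2_norm_sq (\<lambda>x. s n x - f x)) \<longlonglongrightarrow> (\<integral>\<^sup>+x. 0 \<partial>(lebesgue :: (real ^ 'a) measure))"
      unfolding L2_norm_sq_def
    \<comment> \<open>The constant 9 is the square of \<open>2 + 1\<close>: the simple functions are
      bounded by twice \<open>norm (f x)\<close>.\<close>
    proof (rule nn_integral_dominated_convergence[where w = "\<lambda>x. ennreal (9 * (norm (f x))\<^sup>2)"])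
      show "AE x in lebesgue. ennreal ((norm (s n x - f x))\<^sup>2) \<le> ennreal (9 * (norm (f x))\<^sup>2)" for n
      proof (intro AE_I2 ennreal_leI)
        fix x
        have "norm (s n x - f x) \<le> 3 * norm (f x)"
          using norm_triangle_ineq4[of "s n x" "f x"] s(3)[of n x] by simp
        then have "(norm (s n x - f x))\<^sup>2 \<le> (3 * norm (f x))\<^sup>2" by (intro power_mono) auto
        then show "(norm (s n x - f x))\<^sup>2 \<le> 9 * (norm (f x))\<^sup>2" by (simp add: power_mult_distrib)
      qed
      have "(\<integral>\<^sup>+x. ennreal (9 * (norm (f x))\<^sup>2) \<partial>lebesgue) = 9 * L2_norm_sq f"
        unfolding L2_norm_sq_def by (simp add: ennreal_mult nn_integral_cmult)
      then show "(\<integral>\<^sup>+x. ennreal (9 * (norm (f x))\<^sup>2) \<partial>lebesgue) < \<infinity>"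
        using L2_norm_sq_finite[OF f(2)] by (simp add: ennreal_mult_less_top)
      show "AE x in lebesgue. (\<lambda>n. ennreal ((norm (s n x - f x))\<^sup>2)) \<longlonglongrightarrow> 0"
      proof (intro AE_I2)
        fix x
        have "(\<lambda>n. ennreal ((norm (s n x - f x))\<^sup>2)) \<longlonglongrightarrow> ennreal ((norm (f x - f x))\<^sup>2)"
          by (intro tendsto_intros s)
        then show "(\<lambda>n. ennreal ((norm (s n x - f x))\<^sup>2)) \<longlonglongrightarrow> 0" by simp
      qed
    qed measurable
    then show "(\<lambda>n. L2_norm_sq (\<lambda>x. s n x - f x)) \<longlonglongrightarrow> 0" by simp
  qed (use f int s(1) in \<open>auto dest: plancherel_simple\<close>)
qed

section \<open>The Fourier transform of square integrable functions\<close>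

lemma L2_norm_sq_add_tendsto_0:
  assumes "\<And>n. a n \<in> borel_measurable lebesgue" "\<And>n. b n \<in> borel_measurable lebesgue"
    and "(\<lambda>n. L2_norm_sq (a n)) \<longlonglongrightarrow> 0" "(\<lambda>n. L2_norm_sq (b n)) \<longlonglongrightarrow> 0"
  shows "(\<lambda>n. L2_norm_sq (\<lambda>x. a n x + b n x)) \<longlonglongrightarrow> 0"
proof (rule tendsto_sandwich[OF _ _ tendsto_const])
  show "\<forall>\<^sub>F n in sequentially. L2_norm_sq (\<lambda>x. a n x + b n x) \<le>
      (L2_norm_sq (a n) + L2_norm_sq (a n)) + (L2_norm_sq (b n) + L2_norm_sq (b n))"
    using L2_norm_sq_add_le[OF assms(1,2)] by (simp add: mult_2)
  show "(\<lambda>n. (L2_norm_sq (a n) + L2_norm_sq (a n)) + (L2_norm_sq (b n) + L2_norm_sq (b n))) \<longlonglongrightarrow> 0"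
    using tendsto_add[OF tendsto_add[OF assms(3,3)] tendsto_add[OF assms(4,4)]] by simp
qed auto

lemma L2_norm_sq_cmult_tendsto_0:
  assumes "\<And>n. a n \<in> borel_measurable lebesgue" "(\<lambda>n. L2_norm_sq (a n)) \<longlonglongrightarrow> 0"
  shows "(\<lambda>n. L2_norm_sq (\<lambda>x. c * a n x)) \<longlonglongrightarrow> 0"
  unfolding L2_norm_sq_cmult[OF assms(1)]
  using ennreal_tendsto_cmult[OF _ assms(2), of "ennreal ((norm c)\<^sup>2)"] by simp

lemma L2_truncation:
  fixes f :: "real ^ 'n \<Rightarrow> complex"
  assumes f: "f \<in> L2"
  defines "v \<equiv> \<lambda>n::nat. \<lambda>x. indicator (cball 0 (real n)) x * f x"
  shows "v n \<in> L2" "integrable lebesgue (v n)" "(\<lambda>n. L2_norm_sq (\<lambda>x. v n x - f x)) \<longlonglongrightarrow> 0"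
proof -
  have [measurable]: "f \<in> borel_measurable lebesgue" using f by (rule L2_measurable)
  have ind [measurable]: "(indicator (cball 0 r) :: real ^ 'n \<Rightarrow> complex) \<in> borel_measurable lebesgue" for r
    by (intro measurable_completion borel_measurable_indicator) simp
  have "(indicator (cball 0 r) :: real ^ 'n \<Rightarrow> complex) \<in> L_infinity" for r
    unfolding L_infinity_def using ind[of r] by (auto intro!: exI[of _ 1] simp: indicator_def)
  from L2_bounded_mult[OF f this] show v: "v n \<in> L2" for n unfolding v_def .
  show "integrable lebesgue (v n)"
    unfolding v_def by (intro L2_mult_integrable L2_indicator f lmeasurable_cball)
  have "(\<lambda>n. L2_norm_sq (\<lambda>x. v n x - f x)) \<longlonglongrightarrow> (\<integral>\<^sup>+x. 0 \<partial>(lebesgue :: (real ^ 'n) measure))"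
    unfolding L2_norm_sq_def
  proof (rule nn_integral_dominated_convergence[where w = "\<lambda>x. ennreal ((norm (f x))\<^sup>2)"])
    show "AE x in lebesgue. ennreal ((norm (v n x - f x))\<^sup>2) \<le> ennreal ((norm (f x))\<^sup>2)" for n
      by (auto simp: v_def indicator_def)
    show "(\<integral>\<^sup>+x. ennreal ((norm (f x))\<^sup>2) \<partial>lebesgue) < \<infinity>"
      using L2_norm_sq_finite[OF f] by (simp add: L2_norm_sq_def)
    show "AE x in lebesgue. (\<lambda>n. ennreal ((norm (v n x - f x))\<^sup>2)) \<longlonglongrightarrow> 0"
    proof (intro AE_I2 tendsto_eventually)
      fix x :: "real ^ 'n"
      obtain k :: nat where "norm x \<le> real k" using real_arch_simple by blast
      then have "\<forall>n\<ge>k. v n x = f x" by (auto simp: v_def indicator_def)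
      then show "\<forall>\<^sub>F n in sequentially. ennreal ((norm (v n x - f x))\<^sup>2) = 0"
        by (auto simp: eventually_sequentially)
    qed
  qed (auto simp: v_def)
  then show "(\<lambda>n. L2_norm_sq (\<lambda>x. v n x - f x)) \<longlonglongrightarrow> 0" by simp
qed

lemma has_fourier_L2_exists:
  assumes f: "f \<in> L2"
  shows "\<exists>F. has_fourier_L2 f F"
proof -
  define v where "v n x = indicator (cball 0 (real n)) x * f x" for n :: nat and x
  have v: "v n \<in> L2" "integrable lebesgue (v n)" "(\<lambda>n. L2_norm_sq (\<lambda>x. v n x - f x)) \<longlonglongrightarrow> 0" for n
    using L2_truncation[OF f] unfolding v_def by auto
  have "\<exists>n\<ge>k. L2_norm_sq (\<lambda>x. v n x - f x) < ennreal ((1/4) ^ k / 4)" for k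
  proof -
    have "\<forall>\<^sub>F n in sequentially. L2_norm_sq (\<lambda>x. v n x - f x) < ennreal ((1/4) ^ k / 4)"
      by (rule order_tendstoD(2)[OF v(3)]) simp
    then obtain N where "\<And>n. n \<ge> N \<Longrightarrow> L2_norm_sq (\<lambda>x. v n x - f x) < ennreal ((1/4) ^ k / 4)"
      by (auto simp: eventually_sequentially)
    then show ?thesis by (intro exI[of _ "max N k"]) auto
  qed
  \<comment> \<open>The extra factor \<open>1/4\<close> pays for the two factors 2 of
    \<open>L2_norm_sq_add_le\<close>: for \<open>n \<le> k\<close> the distance between the
    \<open>k\<close>-th and the \<open>n\<close>-th truncation is then at most
    \<open>(1/4) ^ n\<close>, the rate that completeness asks for.\<close>
  then obtain r where r: "\<And>k. L2_norm_sq (\<lambda>x. v (r k) x - f x) < ennreal ((1/4) ^ k / 4)" by metis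
  define u where "u k = v (r k)" for k
  have u: "u n \<in> L2" "integrable lebesgue (u n)" for n using v by (auto simp: u_def)
  have fast: "L2_norm_sq (\<lambda>\<xi>. fourier_L1 (u k) \<xi> - fourier_L1 (u n) \<xi>) \<le> ennreal ((1/4) ^ n)" if "n \<le> k" for n k
  proof -
    have "L2_norm_sq (\<lambda>\<xi>. fourier_L1 (u k) \<xi> - fourier_L1 (u n) \<xi>) = L2_norm_sq (\<lambda>x. u k x - u n x)"
      unfolding fourier_L1_diff[OF u(2,2), symmetric] using u by (intro plancherel_L1 L2_diff) auto
    also have "\<dots> = L2_norm_sq (\<lambda>x. (u k x - f x) + (f x - u n x))" by simp
    also have "\<dots> \<le> 2 * L2_norm_sq (\<lambda>x. u k x - f x) + 2 * L2_norm_sq (\<lambda>x. f x - u n x)"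
      by (intro L2_norm_sq_add_le L2_measurable L2_diff u f)
    also have "\<dots> \<le> 2 * ennreal ((1/4) ^ k / 4) + 2 * ennreal ((1/4) ^ n / 4)"
      using r[of k] r[of n] L2_norm_sq_minus_commute[of f "u n"]
      by (intro add_mono mult_left_mono) (auto simp: u_def)
    also have "\<dots> = ennreal (2 * ((1/4) ^ k / 4) + 2 * ((1/4) ^ n / 4))"
    proof -
      have "2 * ennreal a + 2 * ennreal b = ennreal (2 * a + 2 * b)" if "0 \<le> a" "0 \<le> b" for a b
        using ennreal_mult[of 2 a] ennreal_mult[of 2 b] ennreal_plus[of "2 * a" "2 * b"] that by simp
      then show ?thesis by this auto
    qed
    also have "\<dots> \<le> ennreal ((1/4) ^ n)"
    proof (rule ennreal_leI)
      have "(1/4 :: real) ^ k \<le> (1/4) ^ n" by (rule power_decreasing[OF that]) auto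
      then show "2 * ((1/4) ^ k / 4) + 2 * ((1/4) ^ n / 4) \<le> (1/4 :: real) ^ n" by linarith
    qed
    finally show ?thesis .
  qed
  obtain F where F: "F \<in> L2" "(\<lambda>n. L2_norm_sq (\<lambda>\<xi>. fourier_L1 (u n) \<xi> - F \<xi>)) \<longlonglongrightarrow> 0"
    using L2_complete_fast[of "\<lambda>n. fourier_L1 (u n)", OF fourier_L1_in_L2[OF u(2,1)] fast] by auto
  have "(\<lambda>n. L2_norm_sq (\<lambda>x. u n x - f x)) \<longlonglongrightarrow> 0"
  proof (rule tendsto_sandwich[OF _ _ tendsto_const])
    have "(\<lambda>k. ennreal ((1/4) ^ k / 4)) \<longlonglongrightarrow> ennreal (0 / 4)"
      by (intro tendsto_ennrealI tendsto_intros LIMSEQ_realpow_zero) auto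
    then show "(\<lambda>k. ennreal ((1/4) ^ k / 4)) \<longlonglongrightarrow> 0" by simp
  qed (use r in \<open>auto simp: u_def less_imp_le\<close>)
  then show ?thesis using F u unfolding has_fourier_L2_def by blast
qed

lemma has_fourier_L2_fourier_L2: "f \<in> L2 \<Longrightarrow> has_fourier_L2 f (fourier_L2 f)"
  unfolding fourier_L2_def by (rule someI_ex[OF has_fourier_L2_exists])

lemma has_fourier_L2_L2: "has_fourier_L2 f F \<Longrightarrow> F \<in> L2"
  by (simp add: has_fourier_L2_def)

lemma has_fourier_L2_L1:
  assumes "integrable lebesgue f" "f \<in> L2" shows "has_fourier_L2 f (fourier_L1 f)"
  unfolding has_fourier_L2_def
  using assms by (intro conjI fourier_L1_in_L2 exI[of _ "\<lambda>_. f"]) (auto simp: L2_norm_sq_def)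

theorem plancherel:
  assumes f: "f \<in> L2" and F: "has_fourier_L2 f F"
  shows "L2_norm_sq F = L2_norm_sq f"
proof -
  obtain u where u: "\<And>n. integrable lebesgue (u n)" "\<And>n. u n \<in> L2"
    "(\<lambda>n. L2_norm_sq (\<lambda>x. u n x - f x)) \<longlonglongrightarrow> 0"
    "(\<lambda>n. L2_norm_sq (\<lambda>\<xi>. fourier_L1 (u n) \<xi> - F \<xi>)) \<longlonglongrightarrow> 0"
    using F unfolding has_fourier_L2_def by blast
  from L2_norm_sq_tendsto[OF _ has_fourier_L2_L2[OF F] u(4)] u
  have "(\<lambda>n. L2_norm_sq (u n)) \<longlonglongrightarrow> L2_norm_sq F"
    by (simp add: plancherel_L1 fourier_L1_in_L2)
  moreover have "(\<lambda>n. L2_norm_sq (u n)) \<longlonglongrightarrow> L2_norm_sq f"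
    by (rule L2_norm_sq_tendsto[OF u(2) f u(3)])
  ultimately show ?thesis by (rule LIMSEQ_unique)
qed

lemma has_fourier_L2_add:
  assumes f: "f \<in> L2" "has_fourier_L2 f F" and g: "g \<in> L2" "has_fourier_L2 g G"
  shows "has_fourier_L2 (\<lambda>x. f x + g x) (\<lambda>\<xi>. F \<xi> + G \<xi>)"
proof -
  obtain u where u: "\<And>n. integrable lebesgue (u n)" "\<And>n. u n \<in> L2"
    "(\<lambda>n. L2_norm_sq (\<lambda>x. u n x - f x)) \<longlonglongrightarrow> 0"
    "(\<lambda>n. L2_norm_sq (\<lambda>\<xi>. fourier_L1 (u n) \<xi> - F \<xi>)) \<longlonglongrightarrow> 0"
    using f unfolding has_fourier_L2_def by blast
  obtain v where v: "\<And>n. integrable lebesgue (v n)" "\<And>n. v n \<in> L2"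
    "(\<lambda>n. L2_norm_sq (\<lambda>x. v n x - g x)) \<longlonglongrightarrow> 0"
    "(\<lambda>n. L2_norm_sq (\<lambda>\<xi>. fourier_L1 (v n) \<xi> - G \<xi>)) \<longlonglongrightarrow> 0"
    using g unfolding has_fourier_L2_def by blast
  note F = has_fourier_L2_L2[OF f(2)] and G = has_fourier_L2_L2[OF g(2)]
  have 1: "(\<lambda>n. L2_norm_sq (\<lambda>x. (u n x + v n x) - (f x + g x))) \<longlonglongrightarrow> 0"
    using L2_norm_sq_add_tendsto_0[OF _ _ u(3) v(3)] u v f g
    by (simp add: L2_measurable L2_diff add_diff_add)
  have 2: "(\<lambda>n. L2_norm_sq (\<lambda>\<xi>. fourier_L1 (\<lambda>x. u n x + v n x) \<xi> - (F \<xi> + G \<xi>))) \<longlonglongrightarrow> 0"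
    using L2_norm_sq_add_tendsto_0[OF _ _ u(4) v(4)] u v F G
    by (simp add: L2_measurable L2_diff add_diff_add fourier_L1_add fourier_L1_in_L2)
  show ?thesis
    unfolding has_fourier_L2_def
    using u v F G 1 2 by (intro conjI L2_add exI[of _ "\<lambda>n x. u n x + v n x"]) (auto intro: L2_add)
qed

lemma has_fourier_L2_cmult:
  assumes f: "f \<in> L2" "has_fourier_L2 f F"
  shows "has_fourier_L2 (\<lambda>x. c * f x) (\<lambda>\<xi>. c * F \<xi>)"
proof -
  obtain u where u: "\<And>n. integrable lebesgue (u n)" "\<And>n. u n \<in> L2"
    "(\<lambda>n. L2_norm_sq (\<lambda>x. u n x - f x)) \<longlonglongrightarrow> 0"
    "(\<lambda>n. L2_norm_sq (\<lambda>\<xi>. fourier_L1 (u n) \<xi> - F \<xi>)) \<longlonglongrightarrow> 0"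
    using f unfolding has_fourier_L2_def by blast
  note F = has_fourier_L2_L2[OF f(2)]
  have 1: "(\<lambda>n. L2_norm_sq (\<lambda>x. c * u n x - c * f x)) \<longlonglongrightarrow> 0"
    using L2_norm_sq_cmult_tendsto_0[OF _ u(3), of c] u f
    by (simp add: L2_measurable L2_diff right_diff_distrib)
  have 2: "(\<lambda>n. L2_norm_sq (\<lambda>\<xi>. fourier_L1 (\<lambda>x. c * u n x) \<xi> - c * F \<xi>)) \<longlonglongrightarrow> 0"
    using L2_norm_sq_cmult_tendsto_0[OF _ u(4), of c] u F
    by (simp add: L2_measurable L2_diff right_diff_distrib fourier_L1_cmult fourier_L1_in_L2)
  show ?thesis
    unfolding has_fourier_L2_def
    using u F 1 2 by (intro conjI L2_cmult exI[of _ "\<lambda>n x. c * u n x"]) (auto intro: L2_cmult)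
qed

lemma has_fourier_L2_diff:
  assumes "f \<in> L2" "has_fourier_L2 f F" "g \<in> L2" "has_fourier_L2 g G"
  shows "has_fourier_L2 (\<lambda>x. f x - g x) (\<lambda>\<xi>. F \<xi> - G \<xi>)"
  using has_fourier_L2_add[OF assms(1,2) L2_cmult[OF assms(3), of "-1"] has_fourier_L2_cmult[OF assms(3,4), of "-1"]]
  by simp

text \<open>Plancherel's theorem for the difference. This carries the Bedrosian identity to the
  frequency side and back; the case \<open>f = g\<close> shows that transforms are unique almost
  everywhere.\<close>

lemma has_fourier_L2_AE_iff:
  assumes "f \<in> L2" "has_fourier_L2 f F" "g \<in> L2" "has_fourier_L2 g G"
  shows "(AE x in lebesgue. f x = g x) \<longleftrightarrow> (AE \<xi> in lebesgue. F \<xi> = G \<xi>)"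
proof -
  have "L2_norm_sq (\<lambda>\<xi>. F \<xi> - G \<xi>) = L2_norm_sq (\<lambda>x. f x - g x)"
    by (rule plancherel[OF L2_diff[OF assms(1,3)] has_fourier_L2_diff[OF assms]])
  moreover have "(\<lambda>\<xi>. F \<xi> - G \<xi>) \<in> borel_measurable lebesgue" "(\<lambda>x. f x - g x) \<in> borel_measurable lebesgue"
    using assms by (auto intro: L2_measurable L2_diff has_fourier_L2_L2)
  ultimately show ?thesis
    using L2_norm_sq_eq_0_iff[of "\<lambda>\<xi>. F \<xi> - G \<xi>"] L2_norm_sq_eq_0_iff[of "\<lambda>x. f x - g x"] by simp
qed

lemma has_fourier_L2_unique:
  "f \<in> L2 \<Longrightarrow> has_fourier_L2 f F \<Longrightarrow> has_fourier_L2 f G \<Longrightarrow> AE \<xi> in lebesgue. F \<xi> = G \<xi>"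
  using has_fourier_L2_AE_iff[of f F f G] by simp

section \<open>Inner products, transforms of products, and inversion\<close>

lemma L2_polarization:
  assumes f: "f \<in> L2" and g: "g \<in> L2"
  shows "(\<integral>x. f x * cnj (g x) \<partial>lebesgue) =
    (complex_of_real (enn2real (L2_norm_sq (\<lambda>x. f x + g x))) - complex_of_real (enn2real (L2_norm_sq (\<lambda>x. f x - g x)))
     + \<i> * complex_of_real (enn2real (L2_norm_sq (\<lambda>x. f x + \<i> * g x)))
     - \<i> * complex_of_real (enn2real (L2_norm_sq (\<lambda>x. f x - \<i> * g x)))) / 4"
proof -
  have eq: "complex_of_real (enn2real (L2_norm_sq h)) = (\<integral>x. h x * cnj (h x) \<partial>lebesgue)"
    and int: "integrable lebesgue (\<lambda>x. h x * cnj (h x))" if "h \<in> L2" for h :: "real ^ 'a \<Rightarrow> complex"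
  proof -
    show "complex_of_real (enn2real (L2_norm_sq h)) = (\<integral>x. h x * cnj (h x) \<partial>lebesgue)"
      unfolding complex_norm_square[symmetric] integral_complex_of_real
      using that by (simp add: L2_norm_sq_eq_integral integral_nonneg_AE)
    show "integrable lebesgue (\<lambda>x. h x * cnj (h x))"
      by (intro L2_mult_integrable L2_cnj that)
  qed
  note * = L2_add[OF f g] L2_diff[OF f g] L2_add[OF f L2_cmult[OF g, of \<i>]] L2_diff[OF f L2_cmult[OF g, of \<i>]]
  have pt: "a * cnj b = ((a + b) * cnj (a + b) - (a - b) * cnj (a - b)
      + \<i> * ((a + \<i> * b) * cnj (a + \<i> * b)) - \<i> * ((a - \<i> * b) * cnj (a - \<i> * b))) / 4" for a b
    by (simp add: algebra_simps)
  show ?thesis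
    unfolding eq[OF *(1)] eq[OF *(2)] eq[OF *(3)] eq[OF *(4)]
    by (subst pt) (use int[OF *(1)] int[OF *(2)] int[OF *(3)] int[OF *(4)] in
      \<open>simp del: complex_cnj_add complex_cnj_diff complex_cnj_mult\<close>)
qed

text \<open>Polarization expresses both inner products by four squared norms, and Plancherel's
  theorem matches these one by one, since the transform is linear.\<close>

theorem parseval:
  assumes f: "f \<in> L2" "has_fourier_L2 f F" and g: "g \<in> L2" "has_fourier_L2 g G"
  shows "(\<integral>x. f x * cnj (g x) \<partial>lebesgue) = (\<integral>\<xi>. F \<xi> * cnj (G \<xi>) \<partial>lebesgue)"
proof -
  note ig = L2_cmult[OF g(1), of \<i>] has_fourier_L2_cmult[OF g, of \<i>]
  show ?thesis
    unfolding L2_polarization[OF f(1) g(1)] L2_polarization[OF has_fourier_L2_L2[OF f(2)] has_fourier_L2_L2[OF g(2)]]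
      plancherel[OF L2_add[OF f(1) g(1)] has_fourier_L2_add[OF f g]]
      plancherel[OF L2_diff[OF f(1) g(1)] has_fourier_L2_diff[OF f g]]
      plancherel[OF L2_add[OF f(1) ig(1)] has_fourier_L2_add[OF f ig]]
      plancherel[OF L2_diff[OF f(1) ig(1)] has_fourier_L2_diff[OF f ig]] ..
qed

lemma L2_inner_tendsto:
  assumes u: "\<And>n. u n \<in> L2" and f: "f \<in> L2" and g: "g \<in> L2"
    and lim: "(\<lambda>n. L2_norm_sq (\<lambda>x. u n x - f x)) \<longlonglongrightarrow> 0"
  shows "(\<lambda>n. \<integral>x. u n x * cnj (g x) \<partial>lebesgue) \<longlonglongrightarrow> (\<integral>x. f x * cnj (g x) \<partial>lebesgue)"
proof -
  have "(\<lambda>n. enn2real (L2_norm_sq (\<lambda>x. u n x + h x))) \<longlonglongrightarrow> enn2real (L2_norm_sq (\<lambda>x. f x + h x))"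
    if h: "h \<in> L2" for h
    using L2_norm_sq_tendsto[OF L2_add[OF u h] L2_add[OF f h]] lim L2_norm_sq_finite[OF L2_add[OF f h]]
    by (intro tendsto_enn2real) auto
  from this[OF g] this[OF L2_cmult[OF g, of "-1"]] this[OF L2_cmult[OF g, of \<i>]] this[OF L2_cmult[OF g, of "-\<i>"]]
  show ?thesis
    unfolding L2_polarization[OF u g] L2_polarization[OF f g]
    by (intro tendsto_divide tendsto_add tendsto_diff tendsto_mult tendsto_of_real tendsto_const) simp_all
qed

lemma L2_reflect:
  assumes "f \<in> L2" shows "(\<lambda>x. f (t - x)) \<in> L2" "L2_norm_sq (\<lambda>x. f (t - x)) = L2_norm_sq f"
proof -
  have "(\<lambda>x. ennreal ((norm (f x))\<^sup>2)) \<in> borel_measurable lebesgue"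
    using L2_measurable[OF assms] by measurable
  from nn_integral_lebesgue_reflect[OF this, of t]
  show "L2_norm_sq (\<lambda>x. f (t - x)) = L2_norm_sq f" by (simp add: L2_norm_sq_def)
  with L2_norm_sq_finite[OF assms] measurable_compose[OF measurable_lebesgue_reflect L2_measurable[OF assms]]
  show "(\<lambda>x. f (t - x)) \<in> L2" by (intro L2_I) auto
qed

text \<open>Modulation, conjugation and reflection all preserve the L2 norm, so they can be applied
  along an approximating sequence and the formula for integrable functions survives the
  limit.\<close>

lemma has_fourier_L2_cnj_modulated:
  assumes f: "f \<in> L2" "has_fourier_L2 f F"
  shows "(\<lambda>x. cnj (f x * phase x \<xi>)) \<in> L2" 
    "has_fourier_L2 (\<lambda>x. cnj (f x * phase x \<xi>)) (\<lambda>\<eta>. cnj (F (\<xi> - \<eta>)))"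
proof -
  obtain u where u: "\<And>n. integrable lebesgue (u n)" "\<And>n. u n \<in> L2"
    "(\<lambda>n. L2_norm_sq (\<lambda>x. u n x - f x)) \<longlonglongrightarrow> 0"
    "(\<lambda>n. L2_norm_sq (\<lambda>\<xi>. fourier_L1 (u n) \<xi> - F \<xi>)) \<longlonglongrightarrow> 0"
    using f unfolding has_fourier_L2_def by blast
  note F = has_fourier_L2_L2[OF f(2)]
  have phase_mult: "(\<lambda>x. h x * phase x \<xi>) \<in> L2" if "h \<in> L2" for h
    using L2_bounded_mult[OF that, of "\<lambda>x. phase x \<xi>"]
    by (simp add: mult.commute L_infinity_def exI[of _ 1] del: exp_minus)
  show "(\<lambda>x. cnj (f x * phase x \<xi>)) \<in> L2" by (intro L2_cnj phase_mult f)
  have 1: "L2_norm_sq (\<lambda>x. cnj (u n x * phase x \<xi>) - cnj (f x * phase x \<xi>)) = L2_norm_sq (\<lambda>x. u n x - f x)" for n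
    by (rule L2_norm_sq_cong_AE, intro AE_I2)
       (simp only: complex_cnj_diff[symmetric] complex_mod_cnj left_diff_distrib[symmetric] norm_mult norm_phase mult_1_right)
  have 2: "L2_norm_sq (\<lambda>\<eta>. fourier_L1 (\<lambda>x. cnj (u n x * phase x \<xi>)) \<eta> - cnj (F (\<xi> - \<eta>))) =
      L2_norm_sq (\<lambda>\<eta>. fourier_L1 (u n) \<eta> - F \<eta>)" for n
  proof -
    have "L2_norm_sq (\<lambda>\<eta>. fourier_L1 (\<lambda>x. cnj (u n x * phase x \<xi>)) \<eta> - cnj (F (\<xi> - \<eta>))) =
        L2_norm_sq (\<lambda>\<eta>. fourier_L1 (u n) (\<xi> - \<eta>) - F (\<xi> - \<eta>))"
      unfolding fourier_L1_cnj_modulated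
      by (rule L2_norm_sq_cong_AE, intro AE_I2) (simp only: complex_cnj_diff[symmetric] complex_mod_cnj)
    also have "\<dots> = L2_norm_sq (\<lambda>\<eta>. fourier_L1 (u n) \<eta> - F \<eta>)"
      by (rule L2_reflect(2)[OF L2_diff[OF fourier_L1_in_L2[OF u(1,2)] F]])
    finally show ?thesis .
  qed
  show "has_fourier_L2 (\<lambda>x. cnj (f x * phase x \<xi>)) (\<lambda>\<eta>. cnj (F (\<xi> - \<eta>)))"
    unfolding has_fourier_L2_def
  proof (intro conjI exI[of _ "\<lambda>n x. cnj (u n x * phase x \<xi>)"] allI)
    show "integrable lebesgue (\<lambda>x. cnj (u n x * phase x \<xi>))" for n
      using integrable_mult_phase[OF u(1)] by (rule integrable_cnj)
  qed (use u 1 2 in \<open>auto intro!: L2_cnj L2_reflect(1)[OF F] phase_mult simp del: complex_cnj_mult exp_minus\<close>)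
qed

text \<open>Parseval's identity for \<open>g\<close> against the conjugated modulation of
  \<open>f\<close>. The outcome is an identity at every frequency, because the product of two L2
  functions is integrable.\<close>

lemma fourier_L1_product:
  fixes f g :: "real ^ 'n \<Rightarrow> complex"
  assumes f: "f \<in> L2" "has_fourier_L2 f F" and g: "g \<in> L2" "has_fourier_L2 g G"
  shows "fourier_L1 (\<lambda>x. f x * g x) \<xi> =
    complex_of_real (fourier_const TYPE('n)) * (\<integral>\<eta>. F (\<xi> - \<eta>) * G \<eta> \<partial>lebesgue)"
proof -
  have "(\<integral>x. f x * g x * phase x \<xi> \<partial>lebesgue) = (\<integral>x. g x * cnj (cnj (f x * phase x \<xi>)) \<partial>lebesgue)"
    by (simp only: complex_cnj_cnj mult_ac)
  also have "\<dots> = (\<integral>\<eta>. G \<eta> * cnj (cnj (F (\<xi> - \<eta>))) \<partial>lebesgue)"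
    by (rule parseval[OF g has_fourier_L2_cnj_modulated[OF f]])
  also have "\<dots> = (\<integral>\<eta>. F (\<xi> - \<eta>) * G \<eta> \<partial>lebesgue)"
    by (simp only: complex_cnj_cnj mult_ac)
  finally show ?thesis by (simp only: fourier_L1_def)
qed

text \<open>If \<open>F\<close> is a transform of \<open>f\<close>, the multiplication formula shows
  that the inner product of \<open>F\<close> with \<open>\<phi>\<close> is the squared norm of
  \<open>f\<close>. By Plancherel this also is the squared norm of \<open>F\<close> and of
  \<open>\<phi>\<close>, so expanding the squared norm of \<open>F - \<phi>\<close> gives 0.
  Boundedness of \<open>f\<close> comes from the integrability of \<open>\<phi>\<close>.\<close>

lemma inverse_fourier:
  assumes \<phi>: "integrable lebesgue \<phi>" "\<phi> \<in> L2"
  defines "f \<equiv> \<lambda>x. fourier_L1 \<phi> (- x)"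
  shows "f \<in> L2" "f \<in> L_infinity" "has_fourier_L2 f \<phi>"
proof -
  have f: "f \<in> L2" "L2_norm_sq f = L2_norm_sq \<phi>"
    using L2_reflect[OF fourier_L1_in_L2[OF \<phi>], of 0] plancherel_L1[OF \<phi>] by (simp_all add: f_def)
  then show "f \<in> L2" by blast
  show "f \<in> L_infinity"
    using L2_measurable[OF f(1)] norm_fourier_L1_le[of \<phi>] by (auto simp: L_infinity_def f_def)
  obtain F where F: "has_fourier_L2 f F" using has_fourier_L2_exists[OF f(1)] by blast
  note FL2 = has_fourier_L2_L2[OF F]
  obtain u where u: "\<And>n. integrable lebesgue (u n)" "\<And>n. u n \<in> L2"
    "(\<lambda>n. L2_norm_sq (\<lambda>x. u n x - f x)) \<longlonglongrightarrow> 0"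
    "(\<lambda>n. L2_norm_sq (\<lambda>\<xi>. fourier_L1 (u n) \<xi> - F \<xi>)) \<longlonglongrightarrow> 0"
    using F unfolding has_fourier_L2_def by blast
  have cnj_hat: "fourier_L1 (\<lambda>\<xi>. cnj (\<phi> \<xi>)) x = cnj (f x)" for x
    using fourier_L1_cnj_modulated[of \<phi> 0 x] by (simp add: f_def)
  \<comment> \<open>The multiplication formula is for integrable functions and \<open>f\<close> may
    fail to be integrable, so it is applied to the approximants \<open>u n\<close> and passed to the
    limit.\<close>
  have "(\<integral>\<xi>. fourier_L1 (u n) \<xi> * cnj (\<phi> \<xi>) \<partial>lebesgue) = (\<integral>x. u n x * cnj (f x) \<partial>lebesgue)" for n
    unfolding cnj_hat[symmetric] by (rule fourier_L1_mult_formula[OF u(1) integrable_cnj[OF \<phi>(1)]])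
  then have "(\<lambda>n. \<integral>x. u n x * cnj (f x) \<partial>lebesgue) \<longlonglongrightarrow> (\<integral>\<xi>. F \<xi> * cnj (\<phi> \<xi>) \<partial>lebesgue)"
    using L2_inner_tendsto[OF fourier_L1_in_L2[OF u(1,2)] FL2 \<phi>(2) u(4)] by simp
  with L2_inner_tendsto[OF u(2) f(1) f(1) u(3)]
  have ip: "(\<integral>\<xi>. F \<xi> * cnj (\<phi> \<xi>) \<partial>lebesgue) = (\<integral>x. f x * cnj (f x) \<partial>lebesgue)"
    by (rule LIMSEQ_unique[symmetric])
  define N where "N = (\<integral>x. (norm (\<phi> x))\<^sup>2 \<partial>lebesgue)"
  have sq: "(\<integral>x. h x * cnj (h x) \<partial>lebesgue) = complex_of_real N" if "h \<in> L2" "L2_norm_sq h = L2_norm_sq \<phi>" for h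
    using that L2_norm_sq_eq_integral[OF that(1)] L2_norm_sq_eq_integral[OF \<phi>(2)]
    unfolding complex_norm_square[symmetric] integral_complex_of_real
    by (simp add: N_def integral_nonneg_AE)
  have 1: "(\<integral>\<xi>. F \<xi> * cnj (\<phi> \<xi>) \<partial>lebesgue) = complex_of_real N" using ip sq[OF f] by simp
  have "(\<integral>\<xi>. \<phi> \<xi> * cnj (F \<xi>) \<partial>lebesgue) = cnj (\<integral>\<xi>. F \<xi> * cnj (\<phi> \<xi>) \<partial>lebesgue)"
    by (subst Bochner_Integration.integral_cnj[symmetric]) (simp add: mult.commute)
  then have 2: "(\<integral>\<xi>. \<phi> \<xi> * cnj (F \<xi>) \<partial>lebesgue) = complex_of_real N" by (simp add: 1)
  have 3: "(\<integral>\<xi>. F \<xi> * cnj (F \<xi>) \<partial>lebesgue) = complex_of_real N"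
    using plancherel[OF f(1) F] f(2) by (intro sq FL2) simp
  have 4: "(\<integral>\<xi>. \<phi> \<xi> * cnj (\<phi> \<xi>) \<partial>lebesgue) = complex_of_real N"
    by (intro sq \<phi>) simp
  have "complex_of_real (\<integral>\<xi>. (norm (F \<xi> - \<phi> \<xi>))\<^sup>2 \<partial>lebesgue) = (\<integral>\<xi>. (F \<xi> - \<phi> \<xi>) * cnj (F \<xi> - \<phi> \<xi>) \<partial>lebesgue)"
    by (simp only: integral_complex_of_real[symmetric] complex_norm_square)
  also have "\<dots> = (\<integral>\<xi>. (F \<xi> * cnj (F \<xi>) - F \<xi> * cnj (\<phi> \<xi>)) - (\<phi> \<xi> * cnj (F \<xi>) - \<phi> \<xi> * cnj (\<phi> \<xi>)) \<partial>lebesgue)"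
    by (simp add: algebra_simps)
  also have "\<dots> = ((\<integral>\<xi>. F \<xi> * cnj (F \<xi>) \<partial>lebesgue) - (\<integral>\<xi>. F \<xi> * cnj (\<phi> \<xi>) \<partial>lebesgue)) -
      ((\<integral>\<xi>. \<phi> \<xi> * cnj (F \<xi>) \<partial>lebesgue) - (\<integral>\<xi>. \<phi> \<xi> * cnj (\<phi> \<xi>) \<partial>lebesgue))"
    using FL2 \<phi>(2) by (simp add: L2_mult_integrable L2_cnj)
  also have "\<dots> = 0" unfolding 1 2 3 4 by simp
  finally have "L2_norm_sq (\<lambda>\<xi>. F \<xi> - \<phi> \<xi>) = 0"
    by (simp add: L2_norm_sq_eq_integral[OF L2_diff[OF FL2 \<phi>(2)]])
  then have AE: "AE \<xi> in lebesgue. F \<xi> = \<phi> \<xi>"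
    using L2_norm_sq_eq_0_iff[OF L2_measurable[OF L2_diff[OF FL2 \<phi>(2)]]] by simp
  have "L2_norm_sq (\<lambda>\<xi>. fourier_L1 (u n) \<xi> - F \<xi>) = L2_norm_sq (\<lambda>\<xi>. fourier_L1 (u n) \<xi> - \<phi> \<xi>)" for n
    using AE by (intro L2_norm_sq_cong_AE) auto
  with u \<phi>(2) show "has_fourier_L2 f \<phi>" unfolding has_fourier_L2_def by auto
qed

section \<open>The Bedrosian identity for multipliers\<close>

lemma has_fourier_L2_cong_AE:
  assumes "has_fourier_L2 f F" "F' \<in> L2" "AE \<xi> in lebesgue. F \<xi> = F' \<xi>"
  shows "has_fourier_L2 f F'"
proof -
  have "L2_norm_sq (\<lambda>\<xi>. h \<xi> - F \<xi>) = L2_norm_sq (\<lambda>\<xi>. h \<xi> - F' \<xi>)" for h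
    using assms(3) by (intro L2_norm_sq_cong_AE) auto
  with assms(1,2) show ?thesis unfolding has_fourier_L2_def by simp
qed

section \<open>From local to global almost everywhere; essential supports\<close>

lemma AE_open_obtain:
  fixes U :: "'a::euclidean_space set"
  assumes "open U" "U \<noteq> {}" "AE x in lebesgue. x \<in> U \<longrightarrow> P x"
  obtains x where "x \<in> U" "P x"
proof (rule ccontr)
  assume "\<not> thesis"
  with that have "\<And>x. x \<in> U \<Longrightarrow> \<not> P x" by blast
  with assms(3) have "AE x in lebesgue. x \<notin> U" by (auto elim!: eventually_mono)
  then have "U \<in> null_sets lebesgue"
    using assms(1) by (subst (asm) AE_iff_null_sets[symmetric]) auto
  then show False
    using open_not_negligible[OF assms(1,2)] by (simp add: negligible_iff_null_sets)
qed

text \<open>By Lindelof's theorem countably many of the neighbourhoods have the same union, and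
  countably many null sets can be discarded. This handles the complement of an essential support as
  well as the final patching of local values of \<open>m\<close>.\<close>

lemma AE_locally:
  fixes S :: "'a::euclidean_space set"
  assumes "\<And>x. x \<in> S \<Longrightarrow> \<exists>U. open U \<and> x \<in> U \<and> (AE y in lebesgue. y \<in> U \<longrightarrow> P y)"
  shows "AE y in lebesgue. y \<in> S \<longrightarrow> P y"
proof -
  define \<U> where "\<U> = {U. open U \<and> (AE y in lebesgue. y \<in> U \<longrightarrow> P y)}"
  obtain \<V> where \<V>: "\<V> \<subseteq> \<U>" "countable \<V>" "\<Union>\<V> = \<Union>\<U>"
    by (rule Lindelof[of \<U>]) (auto simp: \<U>_def)
  have "AE y in lebesgue. \<forall>U\<in>\<V>. y \<in> U \<longrightarrow> P y"
    using \<V>(1,2) by (subst AE_ball_countable) (auto simp: \<U>_def)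
  moreover have "S \<subseteq> \<Union>\<V>" unfolding \<V>(3) using assms by (auto simp: \<U>_def)
  ultimately show ?thesis by (auto elim!: eventually_mono)
qed

lemma AE_eq_0_outside_ess_supp:
  assumes "F \<in> borel_measurable lebesgue"
  shows "AE x in lebesgue. x \<notin> ess_supp F \<longrightarrow> F x = 0"
proof -
  have "AE y in lebesgue. y \<in> - ess_supp F \<longrightarrow> F y = 0"
  proof (rule AE_locally)
    fix x assume "x \<in> - ess_supp F"
    then obtain U where U: "open U" "x \<in> U" "emeasure lebesgue (U \<inter> {x. F x \<noteq> 0}) = 0"
      by (auto simp: ess_supp_def simp del: emeasure_completion)
    have "{x. F x \<noteq> 0} \<in> sets lebesgue"
      using measurable_sets[OF assms, of "- {0}"] by (simp add: vimage_def Compl_eq)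
    then have "U \<inter> {x. F x \<noteq> 0} \<in> null_sets lebesgue"
      using U by (intro null_setsI sets.Int) auto
    from AE_not_in[OF this] have "AE y in lebesgue. y \<in> U \<longrightarrow> F y = 0" by (auto elim!: eventually_mono)
    with U show "\<exists>U. open U \<and> x \<in> U \<and> (AE y in lebesgue. y \<in> U \<longrightarrow> F y = 0)" by blast
  qed
  then show ?thesis by simp
qed

lemma ess_supp_subset:
  assumes "closed S" "AE x in lebesgue. x \<notin> S \<longrightarrow> F x = 0"
  shows "ess_supp F \<subseteq> S"
proof (rule ccontr)
  assume "\<not> ess_supp F \<subseteq> S"
  then obtain x where x: "x \<in> ess_supp F" "x \<in> - S" by blast
  have "emeasure lebesgue (- S \<inter> {x. F x \<noteq> 0}) = 0"
  proof -
    have "AE x in lebesgue. x \<notin> - S \<inter> {x. F x \<noteq> 0}"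
      using assms(2) by (auto elim!: eventually_mono)
    then obtain N where "N \<in> null_sets lebesgue" "- S \<inter> {x. F x \<noteq> 0} \<subseteq> N"
      unfolding eventually_ae_filter by auto
    then show ?thesis using emeasure_mono[of _ N lebesgue]
      by (auto simp: null_sets_def le_zero_eq simp del: emeasure_completion)
  qed
  then show False using x assms(1) by (auto simp: ess_supp_def open_Compl simp del: emeasure_completion)
qed

section \<open>Minkowski sums and characteristic sets\<close>

lemma open_set_plus:
  fixes A B :: "'a::real_normed_vector set"
  assumes "open B" shows "open (A + B)"
proof -
  have "A + B = (\<Union>a\<in>A. (+) a ` B)" by (auto simp: set_plus_def)
  then show ?thesis using assms by (auto intro: open_translation)
qed

lemma connected_set_plus:
  fixes A B :: "'a::real_normed_vector set"
  assumes "connected A" "connected B" shows "connected (A + B)"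
  unfolding set_plus_image case_prod_unfold
  by (intro connected_continuous_image connected_Times assms continuous_intros)

lemma open_characteristic_set:
  assumes "open B" "C \<in> components (A + B)"
  shows "open (characteristic_set A B C)"
  unfolding characteristic_set_def
  using open_components[OF open_set_plus[OF assms(1)] assms(2)] open_components[OF assms(1)]
  by (intro open_Un open_Union) auto

text \<open>The sum of two connected sets is a continuous image of their connected product. Hence
  the components through \<open>a\<close> and \<open>b\<close> add up inside the component of
  \<open>a + b\<close>, which places \<open>b\<close> and \<open>a + b\<close> in one characteristic
  set.\<close>

lemma sum_characteristic_set:
  assumes "a \<in> A" "b \<in> B"
  obtains C where "C \<in> components (A + B)" "a + b \<in> C" "b \<in> characteristic_set A B C" "C \<subseteq> characteristic_set A B C"
proof -
  define A' where "A' = connected_component_set A a"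
  define B' where "B' = connected_component_set B b"
  define C where "C = connected_component_set (A + B) (a + b)"
  have ab: "a + b \<in> A + B" using assms by (rule set_plus_intro)
  have c: "A' \<in> components A" "B' \<in> components B" "C \<in> components (A + B)"
    unfolding A'_def B'_def C_def using assms ab by (auto simp: components_def)
  have mem: "a \<in> A'" "b \<in> B'" "a + b \<in> C"
    using assms ab by (auto simp: A'_def B'_def C_def)
  have "A' + B' \<subseteq> C"
    unfolding C_def
  proof (rule connected_component_maximal)
    show "a + b \<in> A' + B'" using mem by (intro set_plus_intro)
    show "connected (A' + B')" by (intro connected_set_plus) (auto simp: A'_def B'_def)
    show "A' + B' \<subseteq> A + B" by (intro set_plus_mono2) (auto simp: A'_def B'_def connected_component_subset)
  qed
  then show ?thesis
    using that[OF c(3) mem(3)] c mem unfolding characteristic_set_def by blast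
qed

section \<open>The Bedrosian identity on the frequency side\<close>

lemma multiplier_bedrosian_iff:
  fixes f g :: "real ^ 'n \<Rightarrow> complex"
  assumes m: "m \<in> L_infinity" and T: "L2_bounded_linear T"
    and Tm: "\<forall>f\<in>L2. AE \<xi> in lebesgue. fourier_L2 (T f) \<xi> = m \<xi> * fourier_L2 f \<xi>"
    and f: "f \<in> L2" "f \<in> L_infinity" "has_fourier_L2 f F"
    and g: "g \<in> L2" "g \<in> L_infinity" "has_fourier_L2 g G"
  shows "(AE x in lebesgue. T (\<lambda>y. f y * g y) x = f x * T g x) \<longleftrightarrow>
    (AE \<xi> in lebesgue. m \<xi> * (\<integral>\<eta>. F (\<xi> - \<eta>) * G \<eta> \<partial>lebesgue) = (\<integral>\<eta>. F (\<xi> - \<eta>) * (m \<eta> * G \<eta>) \<partial>lebesgue))"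
proof -
  let ?k = "complex_of_real (fourier_const TYPE('n))"
  have TL2: "T h \<in> L2" if "h \<in> L2" for h using T that by (simp add: L2_bounded_linear_def)
  \<comment> \<open>Membership in L2 comes from boundedness of \<open>f\<close>, integrability from
    both factors being in L2; together they make the convolution formula available for the L2
    transform.\<close>
  have fg: "(\<lambda>y. f y * g y) \<in> L2" "integrable lebesgue (\<lambda>y. f y * g y)"
    by (rule L2_bounded_mult[OF g(1) f(2)], rule L2_mult_integrable[OF f(1) g(1)])
  have fTg: "(\<lambda>y. f y * T g y) \<in> L2" "integrable lebesgue (\<lambda>y. f y * T g y)"
    by (rule L2_bounded_mult[OF TL2[OF g(1)] f(2)], rule L2_mult_integrable[OF f(1) TL2[OF g(1)]])
  \<comment> \<open>The hypothesis speaks of the chosen representative \<open>fourier_L2\<close>;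
    passing to \<open>m \<eta> * G \<eta>\<close> allows any representative \<open>G\<close>, in
    particular an explicit test function.\<close>
  have hatTg: "has_fourier_L2 (T g) (\<lambda>\<eta>. m \<eta> * G \<eta>)"
  proof (rule has_fourier_L2_cong_AE[OF has_fourier_L2_fourier_L2[OF TL2[OF g(1)]]])
    show "(\<lambda>\<eta>. m \<eta> * G \<eta>) \<in> L2" by (rule L2_bounded_mult[OF has_fourier_L2_L2[OF g(3)] m])
    show "AE \<xi> in lebesgue. fourier_L2 (T g) \<xi> = m \<xi> * G \<xi>"
      using bspec[OF Tm g(1)] has_fourier_L2_unique[OF g(1) has_fourier_L2_fourier_L2[OF g(1)] g(3)]
      by eventually_elim simp
  qed
  have W: "AE \<xi> in lebesgue. fourier_L2 (T (\<lambda>y. f y * g y)) \<xi> = ?k * (m \<xi> * (\<integral>\<eta>. F (\<xi> - \<eta>) * G \<eta> \<partial>lebesgue))"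
    using bspec[OF Tm fg(1)] has_fourier_L2_unique[OF fg(1) has_fourier_L2_fourier_L2[OF fg(1)] has_fourier_L2_L1[OF fg(2,1)]]
    by eventually_elim (simp add: fourier_L1_product[OF f(1,3) g(1,3)])
  have "(AE x in lebesgue. T (\<lambda>y. f y * g y) x = f x * T g x) \<longleftrightarrow>
      (AE \<xi> in lebesgue. fourier_L2 (T (\<lambda>y. f y * g y)) \<xi> = fourier_L1 (\<lambda>y. f y * T g y) \<xi>)"
    by (rule has_fourier_L2_AE_iff[OF TL2[OF fg(1)] has_fourier_L2_fourier_L2[OF TL2[OF fg(1)]] fTg(1) has_fourier_L2_L1[OF fTg(2,1)]])
  also have "\<dots> \<longleftrightarrow> (AE \<xi> in lebesgue. ?k * (m \<xi> * (\<integral>\<eta>. F (\<xi> - \<eta>) * G \<eta> \<partial>lebesgue)) =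
      ?k * (\<integral>\<eta>. F (\<xi> - \<eta>) * (m \<eta> * G \<eta>) \<partial>lebesgue))"
    unfolding fourier_L1_product[OF f(1,3) TL2[OF g(1)] hatTg]
    using W by (auto elim!: eventually_elim2)
  finally show ?thesis by simp
qed

lemma multiplier_bedrosian_if:
  fixes A B :: "(real ^ 'n) set"
  assumes m: "m \<in> L_infinity" and T: "L2_bounded_linear T"
    and Tm: "\<forall>f\<in>L2. AE \<xi> in lebesgue. fourier_L2 (T f) \<xi> = m \<xi> * fourier_L2 f \<xi>"
    and B: "open B"
    and c: "\<forall>C \<in> components (A + B). AE x in lebesgue. x \<in> characteristic_set A B C \<longrightarrow> m x = c C"
  shows "bedrosian_identity T A B"
  unfolding bedrosian_identity_def
proof (intro ballI impI)
  fix f g :: "real ^ 'n \<Rightarrow> complex"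
  assume "f \<in> L2 \<inter> L_infinity" "g \<in> L2 \<inter> L_infinity"
    and supp: "ess_supp (fourier_L2 f) \<subseteq> A" "ess_supp (fourier_L2 g) \<subseteq> B"
  then have f: "f \<in> L2" "f \<in> L_infinity" and g: "g \<in> L2" "g \<in> L_infinity" by auto
  define F where "F = fourier_L2 f"
  define G where "G = fourier_L2 g"
  have F: "has_fourier_L2 f F" "F \<in> L2" and G: "has_fourier_L2 g G" "G \<in> L2"
    unfolding F_def G_def using f g by (auto intro: has_fourier_L2_fourier_L2 has_fourier_L2_L2)
  have F0: "AE x in lebesgue. x \<notin> A \<longrightarrow> F x = 0"
    using AE_eq_0_outside_ess_supp[OF L2_measurable[OF F(2)]] supp(1) by (auto simp: F_def elim!: eventually_mono)
  have G0: "AE x in lebesgue. x \<notin> B \<longrightarrow> G x = 0"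
    using AE_eq_0_outside_ess_supp[OF L2_measurable[OF G(2)]] supp(2) by (auto simp: G_def elim!: eventually_mono)
  \<comment> \<open>Disjoint open sets are countably many, so the exceptional null sets of all
    characteristic sets merge into one.\<close>
  have "countable (components (A + B))"
    using pairwise_disjoint_components[of "A + B"]
    by (intro countable_disjoint_open_subsets)
      (auto intro: open_components open_set_plus[OF B] simp: pairwise_def disjnt_def)
  then have N: "AE x in lebesgue. \<forall>C\<in>components (A + B). x \<in> characteristic_set A B C \<longrightarrow> m x = c C"
    using c by (subst AE_ball_countable) auto
  have "AE \<xi> in lebesgue. m \<xi> * (\<integral>\<eta>. F (\<xi> - \<eta>) * G \<eta> \<partial>lebesgue) = (\<integral>\<eta>. F (\<xi> - \<eta>) * (m \<eta> * G \<eta>) \<partial>lebesgue)"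
    using N
  proof eventually_elim
    case (elim \<xi>)
    \<comment> \<open>The hypothesis on \<open>m\<close> enters twice: at the fixed
      \<open>\<xi>\<close>, which lies outside the exceptional set, and at almost every
      \<open>\<eta>\<close>. Reflection turns the vanishing of \<open>F\<close> off \<open>A\<close>
      into a statement about \<open>\<xi> - \<eta>\<close>.\<close>
    have "AE \<eta> in lebesgue. F (\<xi> - \<eta>) * (m \<eta> * G \<eta>) = m \<xi> * (F (\<xi> - \<eta>) * G \<eta>)"
      using N G0 AE_lebesgue_reflect[OF F0, of \<xi>]
    proof eventually_elim
      case (elim \<eta>)
      show ?case
      proof (cases "\<xi> - \<eta> \<in> A \<and> \<eta> \<in> B")
        case True
        then obtain C where C: "C \<in> components (A + B)" "\<xi> \<in> C" "\<eta> \<in> characteristic_set A B C" "C \<subseteq> characteristic_set A B C"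
          using sum_characteristic_set[of "\<xi> - \<eta>" A \<eta> B] by auto
        then have "m \<xi> = m \<eta>"
          using elim(1) \<open>\<forall>C\<in>components (A + B). \<xi> \<in> characteristic_set A B C \<longrightarrow> m \<xi> = c C\<close> by auto
        then show ?thesis by simp
      qed (use elim in auto)
    qed
    then have "(\<integral>\<eta>. F (\<xi> - \<eta>) * (m \<eta> * G \<eta>) \<partial>lebesgue) = (\<integral>\<eta>. m \<xi> * (F (\<xi> - \<eta>) * G \<eta>) \<partial>lebesgue)"
      by (intro integral_cong_AE borel_measurable_times borel_measurable_const L2_measurable
         L2_reflect(1)[OF F(2)] G L2_bounded_mult[OF G(2) m])
    then show ?case by simp
  qed
  then show "AE x in lebesgue. T (\<lambda>y. f y * g y) x = f x * T g x"
    by (subst multiplier_bedrosian_iff[OF m T Tm f F(1) g G(1)])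
qed

text \<open>Inversion realizes \<open>\<phi>\<close> and \<open>\<psi>\<close> as transforms of
  bounded L2 functions, so the test may be designed entirely in frequency. The sets \<open>S\<close>
  and \<open>S'\<close> are closed so that vanishing outside them confines the essential
  supports.\<close>

lemma multiplier_bedrosian_test_functions:
  fixes A B :: "(real ^ 'n) set"
  assumes m: "m \<in> L_infinity" and T: "L2_bounded_linear T"
    and Tm: "\<forall>f\<in>L2. AE \<xi> in lebesgue. fourier_L2 (T f) \<xi> = m \<xi> * fourier_L2 f \<xi>"
    and bed: "bedrosian_identity T A B"
    and \<phi>: "\<phi> \<in> L2" "integrable lebesgue \<phi>" "AE x in lebesgue. x \<notin> S \<longrightarrow> \<phi> x = 0" "closed S" "S \<subseteq> A"
    and \<psi>: "\<psi> \<in> L2" "integrable lebesgue \<psi>" "AE x in lebesgue. x \<notin> S' \<longrightarrow> \<psi> x = 0" "closed S'" "S' \<subseteq> B"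
  shows "AE \<xi> in lebesgue. m \<xi> * (\<integral>\<eta>. \<phi> (\<xi> - \<eta>) * \<psi> \<eta> \<partial>lebesgue) = (\<integral>\<eta>. \<phi> (\<xi> - \<eta>) * (m \<eta> * \<psi> \<eta>) \<partial>lebesgue)"
proof -
  have supp: "ess_supp (fourier_L2 f) \<subseteq> R"
    if "f \<in> L2" "has_fourier_L2 f h" "AE x in lebesgue. x \<notin> R \<longrightarrow> h x = 0" "closed R" for f h and R :: "(real ^ 'n) set"
  proof (rule ess_supp_subset[OF that(4)])
    show "AE x in lebesgue. x \<notin> R \<longrightarrow> fourier_L2 f x = 0"
      using has_fourier_L2_unique[OF that(1) has_fourier_L2_fourier_L2[OF that(1)] that(2)] that(3)
      by eventually_elim simp
  qed
  note f = inverse_fourier[OF \<phi>(2,1)] and g = inverse_fourier[OF \<psi>(2,1)]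
  have "AE x in lebesgue. T (\<lambda>y. fourier_L1 \<phi> (- y) * fourier_L1 \<psi> (- y)) x = fourier_L1 \<phi> (- x) * T (\<lambda>x. fourier_L1 \<psi> (- x)) x"
    using bed[unfolded bedrosian_identity_def] f(1,2) g(1,2)
      order_trans[OF supp[OF f(1,3) \<phi>(3,4)] \<phi>(5)] order_trans[OF supp[OF g(1,3) \<psi>(3,4)] \<psi>(5)]
    by blast
  then show ?thesis
    by (subst (asm) multiplier_bedrosian_iff[OF m T Tm f g])
qed

text \<open>For \<open>\<xi>\<close> within \<open>e\<close> of \<open>a + b\<close> and
  \<open>\<eta>\<close> within \<open>e\<close> of \<open>b\<close>, the point
  \<open>\<xi> - \<eta>\<close> is within \<open>2 * e\<close> of \<open>a\<close>. The indicator of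
  the larger ball is then 1 throughout the integration, and both convolutions become integrals that
  do not depend on \<open>\<xi>\<close>.\<close>

lemma multiplier_bedrosian_average:
  fixes A B :: "(real ^ 'n) set"
  assumes m: "m \<in> L_infinity" and T: "L2_bounded_linear T"
    and Tm: "\<forall>f\<in>L2. AE \<xi> in lebesgue. fourier_L2 (T f) \<xi> = m \<xi> * fourier_L2 f \<xi>"
    and bed: "bedrosian_identity T A B"
    and e: "0 < e" "cball a (2 * e) \<subseteq> A" "cball b e \<subseteq> B" and h: "h \<in> L_infinity"
  shows "AE \<xi> in lebesgue. \<xi> \<in> ball (a + b) e \<longrightarrow>
    m \<xi> * (\<integral>\<eta>. h \<eta> * indicator (cball b e) \<eta> \<partial>lebesgue) = (\<integral>\<eta>. m \<eta> * (h \<eta> * indicator (cball b e) \<eta>) \<partial>lebesgue)"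
proof -
  define \<psi> where "\<psi> \<eta> = h \<eta> * indicator (cball b e) \<eta>" for \<eta>
  note ind = L2_indicator[OF lmeasurable_cball]
  have \<psi>: "\<psi> \<in> L2" "integrable lebesgue \<psi>"
    unfolding \<psi>_def using h by (auto intro: L2_bounded_mult integrable_mult_L_infinity ind)
  have "AE \<xi> in lebesgue. m \<xi> * (\<integral>\<eta>. indicator (cball a (2 * e)) (\<xi> - \<eta>) * \<psi> \<eta> \<partial>lebesgue) =
      (\<integral>\<eta>. indicator (cball a (2 * e)) (\<xi> - \<eta>) * (m \<eta> * \<psi> \<eta>) \<partial>lebesgue)"
    by (rule multiplier_bedrosian_test_functions[OF m T Tm bed ind(1,2) _ _ e(2) \<psi> _ _ e(3)])
       (auto simp: \<psi>_def)
  then show ?thesis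
    unfolding \<psi>_def[symmetric]
  proof eventually_elim
    case (elim \<xi>)
    show ?case
    proof
      assume \<xi>: "\<xi> \<in> ball (a + b) e"
      have "indicator (cball a (2 * e)) (\<xi> - \<eta>) = (1 :: complex)" if "\<eta> \<in> cball b e" for \<eta>
      proof -
        have "norm ((a + b - \<xi>) + (\<eta> - b)) \<le> norm (a + b - \<xi>) + norm (\<eta> - b)" by (rule norm_triangle_ineq)
        also have "\<dots> \<le> 2 * e" using \<xi> that by (simp add: dist_norm norm_minus_commute)
        finally show ?thesis by (simp add: dist_norm algebra_simps)
      qed
      then have w: "indicator (cball a (2 * e)) (\<xi> - \<eta>) * (w * \<psi> \<eta>) = w * \<psi> \<eta>" for \<eta> w
        by (cases "\<eta> \<in> cball b e") (auto simp: \<psi>_def)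
      have "indicator (cball a (2 * e)) (\<xi> - \<eta>) * \<psi> \<eta> = \<psi> \<eta>" for \<eta>
        using w[of \<eta> 1] by simp
      with w elim show "m \<xi> * integral\<^sup>L lebesgue \<psi> = (\<integral>\<eta>. m \<eta> * \<psi> \<eta> \<partial>lebesgue)"
        by (simp only:)
    qed
  qed
qed

section \<open>Local values of a function given almost everywhere\<close>

definition locally_AE_eq :: "('a::euclidean_space \<Rightarrow> complex) \<Rightarrow> 'a \<Rightarrow> complex \<Rightarrow> bool" where
  "locally_AE_eq m x c \<longleftrightarrow> (\<exists>U. open U \<and> x \<in> U \<and> (AE y in lebesgue. y \<in> U \<longrightarrow> m y = c))"

text \<open>Two neighbourhoods of \<open>x\<close> meet in a nonempty open set, which is not null.
  Thus a local value belongs to the point itself, although \<open>m\<close> may be changed on null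
  sets.\<close>

lemma locally_AE_eq_unique:
  assumes "locally_AE_eq m x c" "locally_AE_eq m x d"
  shows "c = d"
proof -
  obtain U V where U: "open U" "x \<in> U" "AE y in lebesgue. y \<in> U \<longrightarrow> m y = c"
    and V: "open V" "x \<in> V" "AE y in lebesgue. y \<in> V \<longrightarrow> m y = d"
    using assms unfolding locally_AE_eq_def by blast
  have "AE y in lebesgue. y \<in> U \<inter> V \<longrightarrow> c = d"
    using U(3) V(3) by eventually_elim auto
  then obtain y where "c = d"
    using AE_open_obtain[of "U \<inter> V" "\<lambda>_. c = d"] U V by blast
  then show ?thesis .
qed

text \<open>A neighbourhood that witnesses the local value at \<open>x\<close> witnesses the same
  value at each of its points. By uniqueness the local value is a locally constant function, hence
  constant on a connected set.\<close>

lemma locally_AE_eq_connected: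
  assumes "connected S" "\<And>x. x \<in> S \<Longrightarrow> \<exists>c. locally_AE_eq m x c"
  shows "\<exists>c. \<forall>x\<in>S. locally_AE_eq m x c"
proof (cases "S = {}")
  case False
  then obtain a where a: "a \<in> S" by blast
  define v where "v x = (SOME c. locally_AE_eq m x c)" for x
  have v: "locally_AE_eq m x (v x)" if "x \<in> S" for x
    unfolding v_def using someI_ex[OF assms(2)[OF that]] .
  have "v a = v b" if "b \<in> S" for b
  proof (rule connected_local_const[OF assms(1) a that], intro ballI)
    fix x assume x: "x \<in> S"
    obtain U where U: "open U" "x \<in> U" "AE y in lebesgue. y \<in> U \<longrightarrow> m y = v x"
      using v[OF x] unfolding locally_AE_eq_def by blast
    then have "v x = v y" if "y \<in> U" "y \<in> S" for y
      using locally_AE_eq_unique[OF _ v[OF that(2)], of "v x"] that unfolding locally_AE_eq_def by blast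
    with U(1,2) show "\<forall>\<^sub>F y in at x within S. v x = v y"
      unfolding eventually_at_topological by blast
  qed
  with v show ?thesis by (intro exI[of _ "v a"]) auto
qed auto

lemma multiplier_bedrosian_locally_AE_eq:
  fixes A B :: "(real ^ 'n) set"
  assumes m: "m \<in> L_infinity" and T: "L2_bounded_linear T"
    and Tm: "\<forall>f\<in>L2. AE \<xi> in lebesgue. fourier_L2 (T f) \<xi> = m \<xi> * fourier_L2 f \<xi>"
    and bed: "bedrosian_identity T A B"
    and A: "open A" "a \<in> A" and B: "open B" "b \<in> B"
  shows "\<exists>c. locally_AE_eq m (a + b) c \<and> locally_AE_eq m b c"
proof -
  obtain r s where r: "0 < r" "cball a r \<subseteq> A" and s: "0 < s" "cball b s \<subseteq> B"
    using A B by (meson open_contains_cball)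
  \<comment> \<open>A ball of radius \<open>2 * e\<close> has to fit into \<open>A\<close> and one
    of radius \<open>e\<close> into \<open>B\<close>.\<close>
  define e where "e = min (r / 2) s"
  have e: "0 < e" "cball a (2 * e) \<subseteq> A" "cball b e \<subseteq> B"
    using r s by (auto simp: e_def subset_iff)
  note avg = multiplier_bedrosian_average[OF m T Tm bed e]
  let ?I = "\<lambda>\<eta>. indicator (cball b e) \<eta> :: complex"
  note ind = L2_indicator[OF lmeasurable_cball[of b e]]
  define v where "v = measure lebesgue (cball b e)"
  have v: "(\<integral>\<eta>. ?I \<eta> \<partial>lebesgue) = of_real v"
  proof -
    have "(\<integral>\<eta>. ?I \<eta> \<partial>lebesgue) = (\<integral>\<eta>. complex_of_real (indicator (cball b e) \<eta>) \<partial>lebesgue)"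
      by (intro Bochner_Integration.integral_cong) (auto simp: indicator_def)
    then show ?thesis by (simp add: v_def)
  qed
  have v0: "v \<noteq> 0"
    unfolding v_def using content_cball_pos[OF e(1), of b] by simp
  define c where "c = (\<integral>\<eta>. m \<eta> * ?I \<eta> \<partial>lebesgue) / of_real v"
  have c: "AE \<xi> in lebesgue. \<xi> \<in> ball (a + b) e \<longrightarrow> m \<xi> = c"
    using avg[OF const_L_infinity[of 1]] by eventually_elim (use v v0 in \<open>auto simp: c_def field_simps\<close>)
  have mc: "(\<lambda>\<eta>. m \<eta> - c) \<in> L_infinity"
  proof -
    obtain M where M: "AE x in lebesgue. norm (m x) \<le> M" using m by (auto simp: L_infinity_def)
    then have "AE x in lebesgue. norm (m x - c) \<le> M + norm c"
      by eventually_elim (auto intro: order_trans[OF norm_triangle_ineq4])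
    with m show ?thesis by (auto simp: L_infinity_def)
  qed
  define h where "h \<eta> = cnj (m \<eta> - c)" for \<eta>
  have h: "h \<in> L_infinity"
    using mc unfolding L_infinity_def h_def complex_mod_cnj
    by (auto intro: measurable_compose[OF _ borel_measurable_cnj] simp del: complex_cnj_diff)
  have "AE \<xi> in lebesgue. \<xi> \<in> ball (a + b) e \<longrightarrow>
      c * (\<integral>\<eta>. h \<eta> * ?I \<eta> \<partial>lebesgue) = (\<integral>\<eta>. m \<eta> * (h \<eta> * ?I \<eta>) \<partial>lebesgue)"
    using avg[OF h] c by eventually_elim auto
  \<comment> \<open>With \<open>m \<xi>\<close> replaced by \<open>c\<close> the equation no longer
    contains \<open>\<xi>\<close>, so one good point in the ball is enough.\<close>
  from AE_open_obtain[OF _ _ this] e(1)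
  have eq: "c * (\<integral>\<eta>. h \<eta> * ?I \<eta> \<partial>lebesgue) = (\<integral>\<eta>. m \<eta> * (h \<eta> * ?I \<eta>) \<partial>lebesgue)"
    by (metis open_ball centre_in_ball empty_iff)
  have hI: "(\<lambda>\<eta>. h \<eta> * ?I \<eta>) \<in> L2" "integrable lebesgue (\<lambda>\<eta>. h \<eta> * ?I \<eta>)"
    by (rule L2_bounded_mult[OF ind(1) h], rule integrable_mult_L_infinity[OF ind(2) h])
  \<comment> \<open>Since \<open>h\<close> is the conjugate of \<open>m - c\<close>, the squared
    modulus on the ball is \<open>(m - c) * h\<close>; the equation just found says that its
    integral is 0.\<close>
  have "complex_of_real (\<integral>\<eta>. (norm (h \<eta> * ?I \<eta>))\<^sup>2 \<partial>lebesgue) = (\<integral>\<eta>. (m \<eta> - c) * (h \<eta> * ?I \<eta>) \<partial>lebesgue)"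
    unfolding integral_complex_of_real[symmetric]
    by (intro Bochner_Integration.integral_cong refl)
       (auto simp: complex_norm_square[symmetric] h_def indicator_def simp del: complex_cnj_diff)
  also have "\<dots> = (\<integral>\<eta>. m \<eta> * (h \<eta> * ?I \<eta>) \<partial>lebesgue) - c * (\<integral>\<eta>. h \<eta> * ?I \<eta> \<partial>lebesgue)"
    unfolding left_diff_distrib
    by (subst Bochner_Integration.integral_diff) (auto intro: integrable_mult_L_infinity m hI)
  finally have "L2_norm_sq (\<lambda>\<eta>. h \<eta> * ?I \<eta>) = 0"
    using eq by (simp add: L2_norm_sq_eq_integral[OF hI(1)] del: of_real_eq_0_iff) simp
  then have "AE \<eta> in lebesgue. h \<eta> * ?I \<eta> = 0"
    using L2_norm_sq_eq_0_iff[OF L2_measurable[OF hI(1)]] by simp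
  then have "AE \<eta> in lebesgue. \<eta> \<in> ball b e \<longrightarrow> m \<eta> = c"
    by eventually_elim (auto simp: h_def indicator_def)
  with c e(1) show ?thesis
    unfolding locally_AE_eq_def by (meson open_ball centre_in_ball)
qed

lemma multiplier_bedrosian_only_if:
  fixes A B :: "(real ^ 'n) set"
  assumes m: "m \<in> L_infinity" and T: "L2_bounded_linear T"
    and Tm: "\<forall>f\<in>L2. AE \<xi> in lebesgue. fourier_L2 (T f) \<xi> = m \<xi> * fourier_L2 f \<xi>"
    and bed: "bedrosian_identity T A B" and A: "open A" and B: "open B"
  shows "\<exists>c. \<forall>C \<in> components (A + B). AE x in lebesgue. x \<in> characteristic_set A B C \<longrightarrow> m x = c C"
proof -
  note loc = multiplier_bedrosian_locally_AE_eq[OF m T Tm bed A _ B]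
  have "\<exists>c. AE x in lebesgue. x \<in> characteristic_set A B C \<longrightarrow> m x = c" if C: "C \<in> components (A + B)" for C
  proof -
    have "\<exists>c. \<forall>x\<in>C. locally_AE_eq m x c"
    proof (rule locally_AE_eq_connected)
      show "connected C" using C by (rule in_components_connected)
      fix x assume "x \<in> C"
      then have "x \<in> A + B" using in_components_subset[OF C] by blast
      then show "\<exists>c. locally_AE_eq m x c" using loc by (auto elim!: set_plus_elim)
    qed
    then obtain c where c: "\<forall>x\<in>C. locally_AE_eq m x c" by blast
    have "locally_AE_eq m x c" if x: "x \<in> characteristic_set A B C" for x
    proof (cases "x \<in> C")
      case False
      with x obtain A' B' where AB: "A' \<in> components A" "B' \<in> components B" "A' + B' \<subseteq> C" "x \<in> B'"
        unfolding characteristic_set_def by blast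
      \<comment> \<open>Any point \<open>a\<close> of \<open>A'\<close> transports the constant from
        \<open>C\<close> to \<open>x\<close>: the point \<open>a + x\<close> lies in
        \<open>C\<close>, and \<open>m\<close> has the same local value at \<open>a + x\<close> and
        at \<open>x\<close>.\<close>
      obtain a where a: "a \<in> A'" using in_components_nonempty[OF AB(1)] by blast
      have "a \<in> A" "x \<in> B" using a AB in_components_subset by blast+
      from loc[OF this] obtain d where d: "locally_AE_eq m (a + x) d" "locally_AE_eq m x d" by blast
      have "a + x \<in> C" using AB(3,4) a by (auto intro: set_plus_intro)
      with c d(1) have "d = c" using locally_AE_eq_unique by blast
      with d(2) show ?thesis by simp
    qed (use c in auto)
    then show ?thesis
      unfolding locally_AE_eq_def by (intro exI[of _ c] AE_locally)
  qed
  then show ?thesis by metis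
qed

theorem theorem1p3:
  fixes A B :: "(real ^ 'n) set"
    and m :: "real ^ 'n \<Rightarrow> complex"
    and T :: "(real ^ 'n \<Rightarrow> complex) \<Rightarrow> real ^ 'n \<Rightarrow> complex"
  assumes "open A" and "A \<noteq> {}" and "open B" and "B \<noteq> {}"
    and "m \<in> L_infinity"
    and "L2_bounded_linear T"
    and "\<And>f. f \<in> L2 \<Longrightarrow> AE \<xi> in lebesgue. fourier_L2 (T f) \<xi> = m \<xi> * fourier_L2 f \<xi>"
  shows "(bedrosian_identity T A B \<longleftrightarrow>
           (\<exists>c :: (real ^ 'n) set \<Rightarrow> complex. \<forall>C \<in> components (A + B).
              AE x in lebesgue. x \<in> characteristic_set A B C \<longrightarrow> m x = c C)) \<and>
         (\<forall>c :: (real ^ 'n) set \<Rightarrow> complex.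
           (\<forall>C \<in> components (A + B).
              AE x in lebesgue. x \<in> characteristic_set A B C \<longrightarrow> m x = c C) \<longrightarrow>
           (\<forall>C \<in> components (A + B). \<forall>C' \<in> components (A + B).
              characteristic_set A B C \<inter> characteristic_set A B C' \<noteq> {} \<longrightarrow> c C = c C'))"
proof (intro conjI allI impI ballI)
  have Tm: "\<forall>f\<in>L2. AE \<xi> in lebesgue. fourier_L2 (T f) \<xi> = m \<xi> * fourier_L2 f \<xi>"
    using assms(7) by blast
  show "bedrosian_identity T A B \<longleftrightarrow>
      (\<exists>c. \<forall>C \<in> components (A + B). AE x in lebesgue. x \<in> characteristic_set A B C \<longrightarrow> m x = c C)"
    using multiplier_bedrosian_only_if[OF assms(5,6) Tm _ assms(1,3)]
      multiplier_bedrosian_if[OF assms(5,6) Tm assms(3)] by blast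
next
  fix c C C'
  assume c: "\<forall>C \<in> components (A + B). AE x in lebesgue. x \<in> characteristic_set A B C \<longrightarrow> m x = c C"
    and C: "C \<in> components (A + B)" "C' \<in> components (A + B)"
    and ne: "characteristic_set A B C \<inter> characteristic_set A B C' \<noteq> {}"
  \<comment> \<open>Characteristic sets are open, so both are neighbourhoods of the common point and
    both constants are the local value of \<open>m\<close> there.\<close>
  then obtain x where "x \<in> characteristic_set A B C" "x \<in> characteristic_set A B C'" by blast
  with c C show "c C = c C'"
    using open_characteristic_set[OF assms(3)]
    by (intro locally_AE_eq_unique[of m x]) (auto simp: locally_AE_eq_def)
qed

end
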